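(* Let $n\ge 1$, $0<s<1$, let $\Omega\subset\mathbb{R}^n$ be a bounded domain, and let $\lambda_1^{s+\ln}(\Omega)\le\lambda_2^{s+\ln}(\Omega)\le\cdots\uparrow+\infty$ be the Dirichlet eigenvalues of the fractional-logarithmic Laplacian $(-\Delta)^{s+\ln}$ on $\Omega$. Then for every integer $k\ge 1$, $$\sum_{j=1}^{k}\lambda_j^{s+\ln}(\Omega)\ \ge\ -(2\pi)^{-n}\,\frac{2n\omega_n}{(n+2s)^2}\,|\Omega|,$$ and, if in addition $k\ge(2\pi)^{-n}\omega_n|\Omega|$, then $$\sum_{j=1}^{k}\lambda_j^{s+\ln}(\Omega)\ \ge\ \frac{2}{n+2s}(2\pi)^{2s}(\omega_n|\Omega|)^{-2s/n}\,k^{1+2s/n}\left(\ln\frac{(2\pi)^n k}{\omega_n|\Omega|}-\frac{n}{n+2s}\right).$$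
   Context: $\omega_n=\pi^{n/2}/\Gamma(\frac n2+1)$ is the volume of the unit ball of $\mathbb{R}^n$ and $|\Omega|$ is Lebesgue measure. Fourier transform: $\widehat u(\xi)=(2\pi)^{-n/2}\int_{\mathbb{R}^n}u(x)e^{-ix\cdot\xi}\,dx$. The fractional-logarithmic Laplacian $(-\Delta)^{s+\ln}$ is the operator with Fourier symbol $|\xi|^{2s}\ln|\xi|^2$. Its energy space on $\Omega$ is $\mathcal{H}_0^{s+\ln}(\Omega)=\{u\in L^2(\mathbb{R}^n):u=0\text{ a.e. in }\mathbb{R}^n\setminus\Omega,\ \int_{\mathbb{R}^n}|\xi|^{2s}\,|\ln|\xi|^2|\,|\widehat u(\xi)|^2d\xi<\infty\}$, with quadratic form $\mathcal{E}(u,v)=\int_{\mathbb{R}^n}|\xi|^{2s}\ln|\xi|^2\,\widehat u(\xi)\overline{\widehat v(\xi)}\,d\xi$. The Dirichlet eigenvalues $\lambda_j^{s+\ln}(\Omega)$ (known to exist, to form a discrete nondecreasing sequence tending to $+\infty$, and listed with multiplicity) are those of this form: there is an orthonormal basis $\{\phi_j\}_{j\ge1}$ of $L^2(\Omega)$ with $\phi_j\in\mathcal{H}_0^{s+\ln}(\Omega)$ (extended by zero) and $\mathcal{E}(\phi_j,v)=\lambda_j^{s+\ln}(\Omega)\int_\Omega\phi_j\overline v\,dx$ for all $v\in\mathcal{H}_0^{s+\ln}(\Omega)$. *)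

theory Defs
  imports "HOL-Analysis.Analysis"
begin

text \<open>\<open>L\<^sup>2\<close> spaces are represented by functions rather than by almost-everywhere classes.
  \<open>L2 lebesgue\<close> is $L^2(\mathbb{R}^n)$ and \<open>L2 (lebesgue_on \<Omega>)\<close> is $L^2(\Omega)$.\<close>

definition L2 :: "'a measure \<Rightarrow> ('a \<Rightarrow> complex) set" where
  "L2 M = {f. f \<in> borel_measurable M \<and> integrable M (\<lambda>x. (cmod (f x))\<^sup>2)}"

definition L2_inner :: "'a measure \<Rightarrow> ('a \<Rightarrow> complex) \<Rightarrow> ('a \<Rightarrow> complex) \<Rightarrow> complex" where
  "L2_inner M f g = (LINT x|M. f x * cnj (g x))"

text \<open>Sequences are indexed from 1; the value at index 0 is irrelevant.\<close>

definition L2_orthonormal_basis :: "'a measure \<Rightarrow> (nat \<Rightarrow> 'a \<Rightarrow> complex) \<Rightarrow> bool" where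
  "L2_orthonormal_basis M \<phi> \<longleftrightarrow>
     (\<forall>j\<ge>1. \<phi> j \<in> L2 M) \<and>
     (\<forall>i\<ge>1. \<forall>j\<ge>1. L2_inner M (\<phi> i) (\<phi> j) = (if i = j then 1 else 0)) \<and>
     (\<forall>f\<in>L2 M. (\<lambda>N. LINT x|M. (cmod (f x - (\<Sum>j=1..N. L2_inner M f (\<phi> j) * \<phi> j x)))\<^sup>2)
        \<longlonglongrightarrow> 0)"

text \<open>The integral is the Fourier transform for integrable \<open>u\<close>. It is only applied to
  square-integrable functions vanishing almost everywhere outside a bounded set, which are
  integrable, so no extension by density is needed.\<close>

definition fourier :: "(real^'n \<Rightarrow> complex) \<Rightarrow> real^'n \<Rightarrow> complex" where
  "fourier u \<xi> = complex_of_real ((2 * pi) powr (- real CARD('n) / 2)) *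
     (LINT x|lebesgue. u x * exp (- (\<i> * complex_of_real (x \<bullet> \<xi>))))"

text \<open>At $\xi = 0$ this takes the value 0, which is also the limit when $s > 0$.\<close>

definition fraclog_symbol :: "real \<Rightarrow> real^'n \<Rightarrow> real" where
  "fraclog_symbol s \<xi> = norm \<xi> powr (2 * s) * ln ((norm \<xi>)\<^sup>2)"

definition energy_space :: "real \<Rightarrow> (real^'n) set \<Rightarrow> (real^'n \<Rightarrow> complex) set" where
  "energy_space s \<Omega> = {u \<in> L2 lebesgue. (AE x in lebesgue. x \<notin> \<Omega> \<longrightarrow> u x = 0) \<and>
     integrable lebesgue (\<lambda>\<xi>. \<bar>fraclog_symbol s \<xi>\<bar> * (cmod (fourier u \<xi>))\<^sup>2)}"

definition energy :: "real \<Rightarrow> (real^'n \<Rightarrow> complex) \<Rightarrow> (real^'n \<Rightarrow> complex) \<Rightarrow> complex" where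
  "energy s u v =
     (LINT \<xi>|lebesgue. complex_of_real (fraclog_symbol s \<xi>) * fourier u \<xi> * cnj (fourier v \<xi>))"

text \<open>\<open>lam 1 \<le> lam 2 \<le> \<dots>\<close> is the sequence of Dirichlet eigenvalues on \<open>\<Omega>\<close>, listed with
  multiplicity. Such a sequence is unique, being determined by an orthonormal basis of
  eigenfunctions and the ordering.\<close>

definition dirichlet_eigenvalues :: "real \<Rightarrow> (real^'n) set \<Rightarrow> (nat \<Rightarrow> real) \<Rightarrow> bool" where
  "dirichlet_eigenvalues s \<Omega> lam \<longleftrightarrow>
     mono_on {1..} lam \<and> filterlim lam at_top sequentially \<and>
     (\<exists>\<phi>. L2_orthonormal_basis (lebesgue_on \<Omega>) \<phi> \<and>
        (\<forall>j\<ge>1. \<phi> j \<in> energy_space s \<Omega> \<and>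
           (\<forall>v\<in>energy_space s \<Omega>.
              energy s (\<phi> j) v = complex_of_real (lam j) * L2_inner (lebesgue_on \<Omega>) (\<phi> j) v)))"

end

theory Submission
  imports Defs "HOL-Probability.Characteristic_Functions" "HOL-Real_Asymp.Real_Asymp"
begin

text \<open>
  Following Berezin, Li and Yau, put $F(\xi) = \sum_{j \le k} |\widehat{\phi_j}(\xi)|^2$. The sum of the
  first $k$ eigenvalues is the integral of the symbol against $F$. Bessel's inequality, applied
  on $\Omega$ to the exponentials $x \mapsto e^{i x \cdot \xi}$, gives
  $0 \le F \le M = (2\pi)^{-n} |\Omega|$, and Plancherel gives $\int F \ge k$.
  Keeping only the region where the symbol is negative, namely the unit ball, and replacing
  $F$ by $M$ there yields the first bound. If $k \ge M \omega_n$, the ball of radius $R$ with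
  $M \omega_n R^n = k$ has $R \ge 1$; the symbol is at most its value on the sphere of radius $R$ inside this
  ball, at least that value outside, and nonnegative on the sphere, so the integral is
  smallest for $F = M 1_{B_R}$, which is the second bound.

  Only one half of Plancherel's theorem is needed. For square-integrable $f$ of bounded
  support, $|\widehat f|^2$ is the Fourier transform of the autocorrelation $A$ of $f$, so damping
  $|\widehat f|^2$ by a Gaussian averages $A$ against a concentrating Gaussian, and $A$ is continuous
  at $0$ because translations are continuous in $L^2$.
\<close>

subsection \<open>The Fourier transform of the Gaussian\<close>

text \<open>\<open>lborel\<close> on a Euclidean space is the image of the finite product of real
  Lebesgue measures under \<open>g \<mapsto> \<Sum>b\<in>Basis. g b *\<^sub>R b\<close>. Transported
  along this map, a product of functions of single coordinates falls under Fubini for finite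
  products.\<close>

lemma
  fixes f :: "'a::euclidean_space \<Rightarrow> real \<Rightarrow> 'b::{real_normed_field, banach, second_countable_topology}"
  assumes f: "\<And>b. b \<in> Basis \<Longrightarrow> integrable lborel (f b)"
  shows integrable_lborel_prod_Basis: "integrable lborel (\<lambda>x::'a. \<Prod>b\<in>Basis. f b (x \<bullet> b))"
    and integral_lborel_prod_Basis:
      "(LBINT x::'a. (\<Prod>b\<in>Basis. f b (x \<bullet> b))) = (\<Prod>b\<in>Basis. LBINT t. f b t)"
proof -
  interpret product_sigma_finite "\<lambda>_::'a. lborel :: real measure"
    by standard
  have [measurable]: "f b \<in> borel_measurable borel" if "b \<in> Basis" for b
    using borel_measurable_integrable[OF f[OF that]] by simp
  have meas: "(\<lambda>f. \<Sum>b\<in>Basis. f b *\<^sub>R b) \<in> (\<Pi>\<^sub>M b\<in>Basis. lborel) \<rightarrow>\<^sub>M (borel :: 'a measure)"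
    by measurable
  have meas2: "(\<lambda>x::'a. \<Prod>b\<in>Basis. f b (x \<bullet> b)) \<in> borel_measurable borel"
    by measurable
  have eq: "(\<Prod>b\<in>Basis. f b ((\<Sum>c\<in>Basis. g c *\<^sub>R c) \<bullet> b)) = (\<Prod>b\<in>Basis. f b (g b))" for g
    by (rule prod.cong) auto
  show "integrable lborel (\<lambda>x::'a. \<Prod>b\<in>Basis. f b (x \<bullet> b))"
    unfolding lborel_eq[where 'a='a]
    by (subst integrable_distr_eq[OF meas meas2])
       (simp add: eq product_integrable_prod f)
  show "(LBINT x::'a. (\<Prod>b\<in>Basis. f b (x \<bullet> b))) = (\<Prod>b\<in>Basis. LBINT t. f b t)"
    by (subst lborel_eq[where 'a='a], subst integral_distr[OF meas meas2])
       (simp add: eq product_integral_prod f)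
qed

text \<open>The standard normal density on the space: total mass 1, with characteristic function
  \<open>exp (- (norm z)\<^sup>2 / 2)\<close>.\<close>

definition gauss :: "'a::euclidean_space \<Rightarrow> real" where
  "gauss x = (2 * pi) powr (- real DIM('a) / 2) * exp (- (norm x)\<^sup>2 / 2)"

lemma gauss_nonneg: "0 \<le> gauss x"
  by (simp add: gauss_def)

lemma borel_measurable_gauss [measurable]: "gauss \<in> borel_measurable borel"
  unfolding gauss_def[abs_def] by measurable

text \<open>Squared norm and inner product are sums over coordinates, so both exponentials factor.
  Each factor has the shape of the integrand in the characteristic function of the one-dimensional
  normal distribution, whose value is known.\<close>

lemma exp_inner_gauss_eq_prod:
  fixes x z :: "'a::euclidean_space"
  shows "complex_of_real (gauss x) * exp (\<i> * complex_of_real (x \<bullet> z)) =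
    (\<Prod>b\<in>Basis. std_normal_density (x \<bullet> b) *\<^sub>R exp (\<i> * complex_of_real ((z \<bullet> b) * (x \<bullet> b))))"
proof -
  have n: "(norm x)\<^sup>2 = (\<Sum>b\<in>Basis. (x \<bullet> b)\<^sup>2)"
    unfolding power2_norm_eq_inner by (subst euclidean_inner) (simp add: power2_eq_square)
  have "1 / sqrt (2 * pi) = (2 * pi) powr (- 1 / 2)"
    using powr_minus[of "2 * pi" "1/2"] by (simp add: powr_half_sqrt inverse_eq_divide)
  then have "(1 / sqrt (2 * pi)) ^ DIM('a) = ((2 * pi) powr (- 1 / 2)) powr real DIM('a)"
    by (subst powr_realpow) auto
  also have "\<dots> = (2 * pi) powr (- real DIM('a) / 2)"
    unfolding powr_powr by simp
  finally have c: "(1 / sqrt (2 * pi)) ^ DIM('a) = (2 * pi) powr (- real DIM('a) / 2)" .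
  have "(\<Prod>b\<in>Basis. exp (- (x \<bullet> b)\<^sup>2 / 2)) = exp (- (norm x)\<^sup>2 / 2)"
    unfolding n by (subst exp_sum[symmetric]) (auto simp: sum_negf sum_divide_distrib)
  then have 1: "gauss x = (\<Prod>b\<in>Basis. std_normal_density (x \<bullet> b))"
    unfolding gauss_def std_normal_density_def prod.distrib prod_constant c by simp
  have "\<i> * complex_of_real (x \<bullet> z) = (\<Sum>b\<in>Basis. \<i> * complex_of_real ((z \<bullet> b) * (x \<bullet> b)))"
    unfolding euclidean_inner[of x z] by (simp add: sum_distrib_left mult_ac)
  then have 2: "exp (\<i> * complex_of_real (x \<bullet> z)) = (\<Prod>b\<in>Basis. exp (\<i> * complex_of_real ((z \<bullet> b) * (x \<bullet> b))))"
    by (simp only: exp_sum[OF finite_Basis])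
  show ?thesis
    unfolding 1 2 by (simp add: prod.distrib scaleR_conv_of_real)
qed

lemma integrable_std_normal_iexp:
  "integrable lborel (\<lambda>x. std_normal_density x *\<^sub>R exp (\<i> * complex_of_real (t * x)))"
  by (rule Bochner_Integration.integrable_bound[where f = "std_normal_density"])
     auto

lemma integral_std_normal_iexp:
  "(LBINT x. std_normal_density x *\<^sub>R exp (\<i> * complex_of_real (t * x))) = exp (- (t\<^sup>2) / 2)"
proof -
  have "char std_normal_distribution t = (LBINT x. std_normal_density x *\<^sub>R exp (\<i> * complex_of_real (t * x)))"
    unfolding char_def by (subst integral_density) auto
  then show ?thesis by (simp add: char_std_normal_distribution)
qed

lemma
  fixes z :: "'a::euclidean_space"
  shows integrable_gauss_iexp:
    "integrable lborel (\<lambda>x::'a. complex_of_real (gauss x) * exp (\<i> * complex_of_real (x \<bullet> z)))"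
    and integral_gauss_iexp:
    "(LBINT x::'a. complex_of_real (gauss x) * exp (\<i> * complex_of_real (x \<bullet> z))) =
       exp (- (norm z)\<^sup>2 / 2)"
proof -
  show "integrable lborel (\<lambda>x::'a. complex_of_real (gauss x) * exp (\<i> * complex_of_real (x \<bullet> z)))"
    unfolding exp_inner_gauss_eq_prod
    by (rule integrable_lborel_prod_Basis[where f="\<lambda>b x. std_normal_density x *\<^sub>R exp (\<i> * complex_of_real ((z \<bullet> b) * x))"])
       (rule integrable_std_normal_iexp)
  have n: "(norm z)\<^sup>2 = (\<Sum>b\<in>Basis. (z \<bullet> b)\<^sup>2)"
    unfolding power2_norm_eq_inner by (subst euclidean_inner) (simp add: power2_eq_square)
  have "(LBINT x::'a. complex_of_real (gauss x) * exp (\<i> * complex_of_real (x \<bullet> z))) =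
    (\<Prod>b\<in>Basis. complex_of_real (exp (- ((z \<bullet> b)\<^sup>2) / 2)))"
    unfolding exp_inner_gauss_eq_prod
    by (subst integral_lborel_prod_Basis[where f="\<lambda>b x. std_normal_density x *\<^sub>R exp (\<i> * complex_of_real ((z \<bullet> b) * x))"])
       (simp_all only: integrable_std_normal_iexp integral_std_normal_iexp)
  also have "\<dots> = exp (- (norm z)\<^sup>2 / 2)"
    unfolding of_real_prod[symmetric] n
    by (subst exp_sum[symmetric]) (auto simp: sum_negf sum_divide_distrib)
  finally show "(LBINT x::'a. complex_of_real (gauss x) * exp (\<i> * complex_of_real (x \<bullet> z))) =
       exp (- (norm z)\<^sup>2 / 2)" .
qed

lemma
  shows integrable_gauss: "integrable lborel (gauss :: 'a::euclidean_space \<Rightarrow> real)"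
    and integral_gauss: "(LBINT x::'a. gauss x) = 1"
proof -
  \<comment> \<open>At frequency 0 the exponential is 1, so both claims are the case
    \<open>z = 0\<close> of the previous ones.\<close>
  have "integrable lborel (\<lambda>x::'a. Re (complex_of_real (gauss x) * exp (\<i> * complex_of_real (x \<bullet> 0))))"
    by (rule integrable_Re[OF integrable_gauss_iexp])
  then show i: "integrable lborel (gauss :: 'a \<Rightarrow> real)" by simp
  show "(LBINT x::'a. gauss x) = 1"
    using integral_gauss_iexp[of "0::'a"] i by simp
qed

subsection \<open>Continuity of translations in mean square\<close>

lemma norm_diff_power2_le: "(norm (a - b))\<^sup>2 \<le> 2 * (norm a)\<^sup>2 + 2 * (norm (b::'a::real_normed_vector))\<^sup>2"
proof -
  have "(norm (a - b))\<^sup>2 \<le> (norm a + norm b)\<^sup>2"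
    by (intro power_mono norm_triangle_ineq4) simp
  also have "\<dots> \<le> 2 * (norm a)\<^sup>2 + 2 * (norm b)\<^sup>2"
    using sum_squares_bound[of "norm a" "norm b"] by (simp add: power2_sum)
  finally show ?thesis .
qed

lemma integrable_power2_norm_diff:
  fixes f g :: "'a \<Rightarrow> complex"
  assumes [measurable]: "f \<in> borel_measurable M" "g \<in> borel_measurable M"
    and "integrable M (\<lambda>x. (norm (f x))\<^sup>2)" "integrable M (\<lambda>x. (norm (g x))\<^sup>2)"
  shows "integrable M (\<lambda>x. (norm (f x - g x))\<^sup>2)"
proof (rule Bochner_Integration.integrable_bound)
  show "integrable M (\<lambda>x. 2 * (norm (f x))\<^sup>2 + 2 * (norm (g x))\<^sup>2)"
    using assms by simp
qed (auto intro!: norm_diff_power2_le)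

text \<open>A squared stand-in for Minkowski's inequality: it avoids roots at the price of a factor
  2 for each intermediate function.\<close>

lemma integral_power2_norm_diff_le:
  fixes f g h :: "'a \<Rightarrow> complex"
  assumes [measurable]: "f \<in> borel_measurable M" "g \<in> borel_measurable M" "h \<in> borel_measurable M"
    and i: "integrable M (\<lambda>x. (norm (f x))\<^sup>2)" "integrable M (\<lambda>x. (norm (g x))\<^sup>2)"
      "integrable M (\<lambda>x. (norm (h x))\<^sup>2)"
  shows "(LINT x|M. (norm (f x - g x))\<^sup>2) \<le>
    2 * (LINT x|M. (norm (f x - h x))\<^sup>2) + 2 * (LINT x|M. (norm (h x - g x))\<^sup>2)"
proof -
  have *: "(norm (f x - g x))\<^sup>2 \<le> 2 * (norm (f x - h x))\<^sup>2 + 2 * (norm (h x - g x))\<^sup>2" for x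
    using norm_diff_power2_le[of "f x - h x" "g x - h x"] by (simp add: norm_minus_commute)
  have "(LINT x|M. (norm (f x - g x))\<^sup>2) \<le>
    (LINT x|M. 2 * (norm (f x - h x))\<^sup>2 + 2 * (norm (h x - g x))\<^sup>2)"
    by (intro integral_mono * integrable_power2_norm_diff Bochner_Integration.integrable_add
        integrable_mult_right i assms)
  also have "\<dots> = 2 * (LINT x|M. (norm (f x - h x))\<^sup>2) + 2 * (LINT x|M. (norm (h x - g x))\<^sup>2)"
    using integrable_power2_norm_diff[of f M h] integrable_power2_norm_diff[of h M g] i by simp
  finally show ?thesis .
qed

section \<open>Approximation in mean square by continuous functions\<close>

lemma integrable_bounded_support_lborel:
  fixes f :: "'a::euclidean_space \<Rightarrow> 'b::{banach, second_countable_topology}"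
  assumes [measurable]: "f \<in> borel_measurable borel"
    and "\<And>x. norm (f x) \<le> C" and "\<And>x. norm x > B \<Longrightarrow> f x = 0"
  shows "integrable lborel f"
proof (rule Bochner_Integration.integrable_bound)
  show "integrable lborel (\<lambda>x::'a. C * indicator (cball 0 B) x :: real)"
    by (intro integrable_mult_right integrable_real_indicator)
       (auto intro: emeasure_bounded_finite[unfolded infinity_ennreal_def])
  show "AE x in lborel. norm (f x) \<le> norm (C * indicator (cball 0 B) x :: real)"
    using assms(2,3) order_trans[OF norm_ge_zero assms(2)]
    by (auto intro!: AE_I2 simp: indicator_def)
qed simp

text \<open>At each point the truncation agrees with \<open>f\<close> once the level exceeds
  \<open>norm (f x)\<close>, and the squared error is dominated by
  \<open>(norm (f x))\<^sup>2\<close>.\<close>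

lemma L2_approx_bounded:
  fixes f :: "'a \<Rightarrow> complex"
  assumes [measurable]: "f \<in> borel_measurable M"
    and i: "integrable M (\<lambda>x. (norm (f x))\<^sup>2)" and e: "0 < e"
  obtains C where "0 \<le> C"
    "(LINT x|M. (norm (f x - (if norm (f x) \<le> C then f x else 0)))\<^sup>2) < e"
proof -
  have "(\<lambda>m. LINT x|M. (norm (f x - (if norm (f x) \<le> real m then f x else 0)))\<^sup>2) \<longlonglongrightarrow> (LINT x|M. 0)"
  proof (rule integral_dominated_convergence[where w = "\<lambda>x. (norm (f x))\<^sup>2"])
    show "AE x in M. (\<lambda>m. (norm (f x - (if norm (f x) \<le> real m then f x else 0)))\<^sup>2) \<longlonglongrightarrow> 0"
    proof (rule AE_I2)
      fix x
      have "eventually (\<lambda>m. norm (f x) \<le> real m) sequentially"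
        using filterlim_real_sequentially eventually_ge_at_top
        unfolding filterlim_at_top by auto
      then have "eventually (\<lambda>m. (norm (f x - (if norm (f x) \<le> real m then f x else 0)))\<^sup>2 = 0) sequentially"
        by eventually_elim simp
      then show "(\<lambda>m. (norm (f x - (if norm (f x) \<le> real m then f x else 0)))\<^sup>2) \<longlonglongrightarrow> 0"
        by (rule tendsto_eventually)
    qed
  qed (use i in auto)
  then have "eventually (\<lambda>m. (LINT x|M. (norm (f x - (if norm (f x) \<le> real m then f x else 0)))\<^sup>2) < e) sequentially"
    using e by (intro order_tendstoD) auto
  then obtain m :: nat where "(LINT x|M. (norm (f x - (if norm (f x) \<le> real m then f x else 0)))\<^sup>2) < e"
    by (auto simp: eventually_sequentially)
  then show thesis by (intro that[of "real m"]) auto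
qed

text \<open>A Lebesgue measurable function is almost everywhere a limit of continuous functions
  (\<open>measurable_on\<close>). These come without bounds, so they are first forced into a disc of
  values and into a ball of arguments; dominated convergence then yields convergence in mean
  square.\<close>

lemma L2_approx_continuous_of_bounded:
  fixes h :: "'a::euclidean_space \<Rightarrow> complex"
  assumes h[measurable]: "h \<in> borel_measurable borel" and "0 \<le> C" and C: "\<And>x. norm (h x) \<le> C"
    and B: "\<And>x. norm x > B \<Longrightarrow> h x = 0" and e: "0 < e"
  obtains g where "continuous_on UNIV g" "\<And>x. norm (g x) \<le> C" "\<And>x. norm x > B + 1 \<Longrightarrow> g x = 0"
    "(LBINT x. (norm (h x - g x))\<^sup>2) < e"
proof -
  have "h \<in> borel_measurable lebesgue"
    using measurable_completion[of h lborel borel] by simp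
  then have "h measurable_on UNIV"
    by (intro lebesgue_measurable_imp_measurable_on) auto
  then obtain N G where N: "negligible N" and G: "\<And>n. continuous_on UNIV (G n :: 'a \<Rightarrow> complex)"
    and lim: "\<And>x. x \<notin> N \<Longrightarrow> (\<lambda>n. G n x) \<longlonglongrightarrow> h x"
    by (auto simp: measurable_on_def)
  \<comment> \<open>\<open>c\<close> is the projection onto the disc of radius \<open>C\<close>:
    continuous, and the identity on the values of \<open>h\<close>. \<open>u\<close> is a continuous
    cutoff, equal to 1 for \<open>norm x \<le> B\<close> and to 0 for
    \<open>norm x \<ge> B + 1\<close>.\<close>
  define c where "c = closest_point (cball (0::complex) C)"
  define u where "u x = max 0 (min 1 (B + 1 - norm x))" for x :: 'a
  define K where "K n x = u x *\<^sub>R c (G n x)" for n x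
  have cont_c: "continuous_on UNIV c"
    unfolding c_def using \<open>0 \<le> C\<close> by (intro continuous_on_closest_point) auto
  have c_le: "norm (c z) \<le> C" for z
    using closest_point_in_set[of "cball (0::complex) C" z] \<open>0 \<le> C\<close> by (auto simp: c_def)
  have u: "0 \<le> u x" "u x \<le> 1" for x by (auto simp: u_def)
  have cont_K: "continuous_on UNIV (K n)" for n
    unfolding K_def u_def
    by (intro continuous_intros continuous_on_compose2[OF cont_c G]) auto
  have [measurable]: "K n \<in> borel_measurable borel" for n
    using cont_K by (rule borel_measurable_continuous_onI)
  have K_le: "norm (K n x) \<le> C" for n x
    using mult_mono[OF u(2) c_le] u[of x] by (simp add: K_def)
  have K_0: "K n x = 0" if "norm x > B + 1" for n x
    using that by (simp add: K_def u_def)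
  have K_lim: "(\<lambda>n. K n x) \<longlonglongrightarrow> h x" if "x \<notin> N" for x
  proof -
    have "(\<lambda>n. c (G n x)) \<longlonglongrightarrow> c (h x)"
      by (rule continuous_on_tendsto_compose[OF cont_c lim[OF that]]) auto
    then have "(\<lambda>n. K n x) \<longlonglongrightarrow> u x *\<^sub>R c (h x)"
      unfolding K_def by (intro tendsto_intros)
    moreover have "c (h x) = h x"
      unfolding c_def using C[of x] by (intro closest_point_self) simp
    moreover have "u x *\<^sub>R h x = h x"
      using B[of x] by (cases "norm x > B") (auto simp: u_def)
    ultimately show ?thesis by simp
  qed
  have AE: "AE x in lborel. (\<lambda>n. K n x) \<longlonglongrightarrow> h x"
  proof -
    have "AE x in lebesgue. x \<notin> N"
      using N by (auto simp: negligible_iff_null_sets intro: AE_not_in)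
    then have "AE x in lebesgue. (\<lambda>n. K n x) \<longlonglongrightarrow> h x"
      by eventually_elim (rule K_lim)
    then show ?thesis by (simp add: AE_completion_iff)
  qed
  have "(\<lambda>n. LBINT x. (norm (h x - K n x))\<^sup>2) \<longlonglongrightarrow> (LBINT x::'a. 0)"
  proof (rule integral_dominated_convergence[where w = "\<lambda>x. (2 * C)\<^sup>2 * indicator (cball 0 (B+1)) x"])
    show "AE x in lborel. (\<lambda>n. (norm (h x - K n x))\<^sup>2) \<longlonglongrightarrow> 0"
      using AE
    proof eventually_elim
      fix x assume "(\<lambda>n. K n x) \<longlonglongrightarrow> h x"
      then have "(\<lambda>n. (norm (h x - K n x))\<^sup>2) \<longlonglongrightarrow> (norm (h x - h x))\<^sup>2"
        by (intro tendsto_intros)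
      then show "(\<lambda>n. (norm (h x - K n x))\<^sup>2) \<longlonglongrightarrow> 0" by simp
    qed
    show "integrable lborel (\<lambda>x::'a. (2 * C)\<^sup>2 * indicator (cball 0 (B+1)) x :: real)"
      by (intro integrable_mult_right integrable_real_indicator)
         (auto intro: emeasure_bounded_finite[unfolded infinity_ennreal_def])
    show "AE x in lborel. norm ((norm (h x - K n x))\<^sup>2) \<le> (2 * C)\<^sup>2 * indicator (cball 0 (B+1)) x" for n
    proof (rule AE_I2)
      fix x
      have "norm (h x - K n x) \<le> 2 * C"
        using norm_triangle_ineq4[of "h x" "K n x"] C[of x] K_le[of n x] by simp
      then have "(norm (h x - K n x))\<^sup>2 \<le> (2 * C)\<^sup>2"
        by (intro power_mono) auto
      then show "norm ((norm (h x - K n x))\<^sup>2) \<le> (2 * C)\<^sup>2 * indicator (cball 0 (B+1)) x"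
        using B[of x] K_0[of x n] by (auto simp: indicator_def)
    qed
  qed auto
  then have "eventually (\<lambda>n. (LBINT x. (norm (h x - K n x))\<^sup>2) < e) sequentially"
    using e by (intro order_tendstoD) auto
  then obtain n where "(LBINT x. (norm (h x - K n x))\<^sup>2) < e"
    by (auto simp: eventually_sequentially)
  then show thesis by (intro that[of "K n"] cont_K K_le K_0)
qed

lemma L2_approx_continuous:
  fixes f :: "'a::euclidean_space \<Rightarrow> complex"
  assumes f[measurable]: "f \<in> borel_measurable borel" and i: "integrable lborel (\<lambda>x. (norm (f x))\<^sup>2)"
    and B: "\<And>x. norm x > B \<Longrightarrow> f x = 0" and e: "0 < e"
  obtains g C where "continuous_on UNIV g" "\<And>x. norm (g x) \<le> C" "\<And>x. norm x > B + 1 \<Longrightarrow> g x = 0"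
    "(LBINT x. (norm (f x - g x))\<^sup>2) < e"
proof -
  \<comment> \<open>Truncation comes first, and the bounded truncation is then approximated. The
    squared triangle inequality doubles both errors, hence \<open>e / 4\<close> for each.\<close>
  obtain C where C: "0 \<le> C"
    "(LBINT x. (norm (f x - (if norm (f x) \<le> C then f x else 0)))\<^sup>2) < e / 4"
    using L2_approx_bounded[of f lborel "e/4"] i e by auto
  define h where "h x = (if norm (f x) \<le> C then f x else 0)" for x
  have [measurable]: "h \<in> borel_measurable borel" unfolding h_def by measurable
  obtain g where g: "continuous_on UNIV g" "\<And>x. norm (g x) \<le> C" "\<And>x. norm x > B + 1 \<Longrightarrow> g x = 0"
    "(LBINT x. (norm (h x - g x))\<^sup>2) < e / 4"
  proof (rule L2_approx_continuous_of_bounded[of h C B "e / 4"])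
    show "norm (h x) \<le> C" for x using C(1) by (simp add: h_def)
    show "h x = 0" if "norm x > B" for x using B[OF that] by (simp add: h_def)
  qed (use C(1) e in auto)
  have [measurable]: "g \<in> borel_measurable borel"
    using g(1) by (rule borel_measurable_continuous_onI)
  have ih: "integrable lborel (\<lambda>x. (norm (h x))\<^sup>2)"
    by (rule Bochner_Integration.integrable_bound[OF i]) (auto simp: h_def)
  have ig: "integrable lborel (\<lambda>x. (norm (g x))\<^sup>2)"
    by (rule integrable_bounded_support_lborel[where C = "C\<^sup>2" and B = "B+1"])
       (use g in \<open>auto intro: power_mono\<close>)
  have "(LBINT x. (norm (f x - g x))\<^sup>2) \<le> 2 * (LBINT x. (norm (f x - h x))\<^sup>2) + 2 * (LBINT x. (norm (h x - g x))\<^sup>2)"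
    by (rule integral_power2_norm_diff_le) (use i ih ig in auto)
  also have "\<dots> < e" using C(2) g(4) unfolding h_def by simp
  finally show thesis using g by (intro that[of g C]) auto
qed

section \<open>Translations and their continuity in mean square\<close>

lemma lborel_shift: "distr lborel borel (\<lambda>x. x - z) = (lborel :: 'a::euclidean_space measure)"
proof -
  have "(+) (- z) = (\<lambda>x. x - z)" by (auto simp: fun_eq_iff)
  then show ?thesis using lborel_distr_plus[of "- z"] by simp
qed

lemma borel_measurable_cnj [measurable]: "cnj \<in> borel_measurable borel"
  by (intro borel_measurable_continuous_onI continuous_intros)

lemma lborel_reflect: "distr lborel borel (\<lambda>z. x - z) = (lborel :: 'a::euclidean_space measure)"
  using lborel_affine[of "-1" x] by (simp add: density_1)

lemma
  fixes h :: "'a::euclidean_space \<Rightarrow> 'b::{banach, second_countable_topology}"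
  assumes [measurable]: "h \<in> borel_measurable borel"
  shows integrable_lborel_shift: "integrable lborel (\<lambda>x. h (x - z)) \<longleftrightarrow> integrable lborel h"
    and integral_lborel_shift: "(LBINT x. h (x - z)) = (LBINT x. h x)"
proof -
  have m: "(\<lambda>x. x - z) \<in> lborel \<rightarrow>\<^sub>M borel" by measurable
  show "integrable lborel (\<lambda>x. h (x - z)) \<longleftrightarrow> integrable lborel h"
    using integrable_distr_eq[OF m assms] by (simp add: lborel_shift)
  show "(LBINT x. h (x - z)) = (LBINT x. h x)"
    using integral_distr[OF m assms] by (simp add: lborel_shift)
qed

text \<open>Continuity gives pointwise convergence. The shifts converge, so they are bounded by some
  \<open>K\<close>; all integrands then vanish outside the ball of radius \<open>B + K\<close> and
  are at most \<open>(2 * C)\<^sup>2\<close> inside, which permits dominated convergence.\<close>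

lemma translation_tendsto_continuous:
  fixes g :: "'a::euclidean_space \<Rightarrow> complex"
  assumes g: "continuous_on UNIV g" and C: "\<And>x. norm (g x) \<le> C" and B: "\<And>x. norm x > B \<Longrightarrow> g x = 0"
    and z: "z \<longlonglongrightarrow> 0"
  shows "(\<lambda>k. LBINT x. (norm (g x - g (x - z k)))\<^sup>2) \<longlonglongrightarrow> 0"
proof -
  have [measurable]: "g \<in> borel_measurable borel"
    using g by (rule borel_measurable_continuous_onI)
  have "Bseq z" using z by (intro convergent_imp_Bseq) (auto simp: convergent_def)
  then obtain K where K: "\<And>k. norm (z k) \<le> K" "K > 0" by (auto simp: Bseq_def)
  have "(\<lambda>k. LBINT x. (norm (g x - g (x - z k)))\<^sup>2) \<longlonglongrightarrow> (LBINT x::'a. 0)"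
  proof (rule integral_dominated_convergence[where w = "\<lambda>x. (2 * C)\<^sup>2 * indicator (cball 0 (B+K)) x"])
    show "AE x in lborel. (\<lambda>k. (norm (g x - g (x - z k)))\<^sup>2) \<longlonglongrightarrow> 0"
    proof (rule AE_I2)
      fix x
      have "(\<lambda>k. x - z k) \<longlonglongrightarrow> x - 0" using z by (intro tendsto_intros)
      then have "(\<lambda>k. g (x - z k)) \<longlonglongrightarrow> g (x - 0)"
        by (intro continuous_on_tendsto_compose[OF g]) auto
      then have "(\<lambda>k. (norm (g x - g (x - z k)))\<^sup>2) \<longlonglongrightarrow> (norm (g x - g (x - 0)))\<^sup>2"
        by (intro tendsto_intros)
      then show "(\<lambda>k. (norm (g x - g (x - z k)))\<^sup>2) \<longlonglongrightarrow> 0" by simp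
    qed
    show "integrable lborel (\<lambda>x::'a. (2 * C)\<^sup>2 * indicator (cball 0 (B+K)) x :: real)"
      by (intro integrable_mult_right integrable_real_indicator)
         (auto intro: emeasure_bounded_finite[unfolded infinity_ennreal_def])
    show "AE x in lborel. norm ((norm (g x - g (x - z k)))\<^sup>2) \<le> (2 * C)\<^sup>2 * indicator (cball 0 (B+K)) x" for k
    proof (rule AE_I2)
      fix x
      have "norm (g x - g (x - z k)) \<le> 2 * C"
        using norm_triangle_ineq4[of "g x" "g (x - z k)"] C[of x] C[of "x - z k"] by simp
      then have "(norm (g x - g (x - z k)))\<^sup>2 \<le> (2 * C)\<^sup>2"
        by (intro power_mono) auto
      moreover have "g x = 0 \<and> g (x - z k) = 0" if "norm x > B + K"
        using that K(1)[of k] K(2) norm_triangle_ineq2[of x "z k"] by (intro conjI B) auto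
      ultimately show "norm ((norm (g x - g (x - z k)))\<^sup>2) \<le> (2 * C)\<^sup>2 * indicator (cball 0 (B+K)) x"
        by (auto simp: indicator_def)
    qed
  qed auto
  then show ?thesis by simp
qed

text \<open>Density argument: by translation invariance the error of replacing \<open>f\<close> by a
  continuous \<open>g\<close> is the same before and after the shift, hence uniform in the
  shift.\<close>

lemma translation_tendsto:
  fixes f :: "'a::euclidean_space \<Rightarrow> complex"
  assumes f[measurable]: "f \<in> borel_measurable borel" and i: "integrable lborel (\<lambda>x. (norm (f x))\<^sup>2)"
    and B: "\<And>x. norm x > B \<Longrightarrow> f x = 0" and z: "z \<longlonglongrightarrow> 0"
  shows "(\<lambda>k. LBINT x. (norm (f x - f (x - z k)))\<^sup>2) \<longlonglongrightarrow> 0"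
proof (rule LIMSEQ_I)
  fix r :: real assume r: "0 < r"
  obtain g C where g: "continuous_on UNIV g" "\<And>x. norm (g x) \<le> C" "\<And>x. norm x > B + 1 \<Longrightarrow> g x = 0"
    "(LBINT x. (norm (f x - g x))\<^sup>2) < r / 16"
  proof (rule L2_approx_continuous[where f = f and B = B and e = "r / 16", OF f i])
    show "0 < r / 16" using r by simp
  qed (rule B that; assumption)+
  have [measurable]: "g \<in> borel_measurable borel"
    using g(1) by (rule borel_measurable_continuous_onI)
  have ig: "integrable lborel (\<lambda>x. (norm (g x))\<^sup>2)"
    by (rule integrable_bounded_support_lborel[where C = "C\<^sup>2" and B = "B+1"])
       (use g in \<open>auto intro: power_mono\<close>)
  have ifz: "integrable lborel (\<lambda>x. (norm (f (x - z k)))\<^sup>2)" for k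
    using integrable_lborel_shift[of "\<lambda>x. (norm (f x))\<^sup>2"] i by simp
  have igz: "integrable lborel (\<lambda>x. (norm (g (x - z k)))\<^sup>2)" for k
    using integrable_lborel_shift[of "\<lambda>x. (norm (g x))\<^sup>2"] ig by simp
  \<comment> \<open>Replacing \<open>f\<close> by \<open>g\<close> costs 2(r/16), replacing the
    shifted \<open>g\<close> by the shifted \<open>f\<close> costs 4(r/16), together 3r/8. Once the
    integral for \<open>g\<close> is below r/16, the total is at most 5r/8.\<close>
  have le: "(LBINT x. (norm (f x - f (x - z k)))\<^sup>2) \<le> 4 * (LBINT x. (norm (g x - g (x - z k)))\<^sup>2) + r * 3 / 8" for k
  proof -
    have "(LBINT x. (norm (f x - f (x - z k)))\<^sup>2) \<le>
        2 * (LBINT x. (norm (f x - g x))\<^sup>2) + 2 * (LBINT x. (norm (g x - f (x - z k)))\<^sup>2)"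
      by (rule integral_power2_norm_diff_le) (use i ig ifz in auto)
    moreover have "(LBINT x. (norm (g x - f (x - z k)))\<^sup>2) \<le>
        2 * (LBINT x. (norm (g x - g (x - z k)))\<^sup>2) + 2 * (LBINT x. (norm (g (x - z k) - f (x - z k)))\<^sup>2)"
      by (rule integral_power2_norm_diff_le) (use ig igz ifz in auto)
    moreover have "(LBINT x. (norm (g (x - z k) - f (x - z k)))\<^sup>2) = (LBINT x. (norm (f x - g x))\<^sup>2)"
      using integral_lborel_shift[of "\<lambda>x. (norm (f x - g x))\<^sup>2" "z k"] by (simp add: norm_minus_commute)
    ultimately show ?thesis using g(4) by simp
  qed
  have "(\<lambda>k. LBINT x. (norm (g x - g (x - z k)))\<^sup>2) \<longlonglongrightarrow> 0"
    using g(1,2,3) z by (rule translation_tendsto_continuous)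
  then have "eventually (\<lambda>k. (LBINT x. (norm (g x - g (x - z k)))\<^sup>2) < r / 16) sequentially"
    using r by (intro order_tendstoD) auto
  then obtain N where N: "\<And>k. k \<ge> N \<Longrightarrow> (LBINT x. (norm (g x - g (x - z k)))\<^sup>2) < r / 16"
    by (auto simp: eventually_sequentially)
  have "norm ((LBINT x. (norm (f x - f (x - z k)))\<^sup>2) - 0) < r" if "k \<ge> N" for k
  proof -
    have "0 \<le> (LBINT x. (norm (f x - f (x - z k)))\<^sup>2)" by simp
    then show ?thesis using le[of k] N[OF that] r by simp
  qed
  then show "\<exists>N. \<forall>k\<ge>N. norm ((LBINT x. (norm (f x - f (x - z k)))\<^sup>2) - 0) < r" by blast
qed

section \<open>Autocorrelation\<close>

definition autocorr :: "('a::euclidean_space \<Rightarrow> complex) \<Rightarrow> 'a \<Rightarrow> complex" where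
  "autocorr f z = (LBINT x. f x * cnj (f (x - z)))"

lemma borel_measurable_autocorr [measurable]:
  assumes [measurable]: "f \<in> borel_measurable borel"
  shows "autocorr f \<in> borel_measurable borel"
  unfolding autocorr_def[abs_def] by measurable

text \<open>Integrability and the bound come from
  \<open>2 * a * b \<le> a\<^sup>2 + b\<^sup>2\<close> and translation invariance. The real part
  comes from polarization; it reduces continuity at 0 to continuity of translations in mean
  square.\<close>

lemma
  fixes f :: "'a::euclidean_space \<Rightarrow> complex"
  assumes f[measurable]: "f \<in> borel_measurable borel" and i: "integrable lborel (\<lambda>x. (norm (f x))\<^sup>2)"
  shows integrable_autocorr_integrand: "integrable lborel (\<lambda>x. f x * cnj (f (x - z)))"
    and norm_autocorr_le: "norm (autocorr f z) \<le> (LBINT x. (norm (f x))\<^sup>2)"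
    and Re_autocorr: "Re (autocorr f z) = (LBINT x. (norm (f x))\<^sup>2) - (LBINT x. (norm (f x - f (x - z)))\<^sup>2) / 2"
proof -
  have iz: "integrable lborel (\<lambda>x. (norm (f (x - z)))\<^sup>2)"
    using integrable_lborel_shift[of "\<lambda>x. (norm (f x))\<^sup>2"] i by simp
  have ez: "(LBINT x. (norm (f (x - z)))\<^sup>2) = (LBINT x. (norm (f x))\<^sup>2)"
    using integral_lborel_shift[of "\<lambda>x. (norm (f x))\<^sup>2"] by simp
  have le: "norm (f x * cnj (f (x - z))) \<le> ((norm (f x))\<^sup>2 + (norm (f (x - z)))\<^sup>2) / 2" for x
    using sum_squares_bound[of "norm (f x)" "norm (f (x - z))"] by (simp add: norm_mult)
  have i2: "integrable lborel (\<lambda>x. ((norm (f x))\<^sup>2 + (norm (f (x - z)))\<^sup>2) / 2)"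
    using i iz by simp
  show ip: "integrable lborel (\<lambda>x. f x * cnj (f (x - z)))"
    by (rule Bochner_Integration.integrable_bound[OF i2]) (use le in \<open>auto intro: order_trans[OF _ abs_ge_self]\<close>)
  have "norm (autocorr f z) \<le> (LBINT x. norm (f x * cnj (f (x - z))))"
    unfolding autocorr_def by (rule integral_norm_bound)
  also have "\<dots> \<le> (LBINT x. ((norm (f x))\<^sup>2 + (norm (f (x - z)))\<^sup>2) / 2)"
    by (intro integral_mono le i2 integrable_norm ip)
  also have "\<dots> = (LBINT x. (norm (f x))\<^sup>2)"
    using i iz ez by simp
  finally show "norm (autocorr f z) \<le> (LBINT x. (norm (f x))\<^sup>2)" .
  have "Re (f x * cnj (f (x - z))) = ((norm (f x))\<^sup>2 + (norm (f (x - z)))\<^sup>2 - (norm (f x - f (x - z)))\<^sup>2) / 2" for x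
    unfolding cmod_power2 by (simp add: power2_eq_square algebra_simps)
  then have "Re (autocorr f z) = (LBINT x. ((norm (f x))\<^sup>2 + (norm (f (x - z)))\<^sup>2 - (norm (f x - f (x - z)))\<^sup>2) / 2)"
    unfolding autocorr_def using integral_Re[OF ip] by (simp only:)
  also have "\<dots> = (LBINT x. (norm (f x))\<^sup>2) - (LBINT x. (norm (f x - f (x - z)))\<^sup>2) / 2"
    using i iz integrable_power2_norm_diff[of f lborel "\<lambda>x. f (x - z)"] by (simp add: ez field_simps)
  finally show "Re (autocorr f z) = (LBINT x. (norm (f x))\<^sup>2) - (LBINT x. (norm (f x - f (x - z)))\<^sup>2) / 2" .
qed

subsection \<open>Plancherel's inequality\<close>

text \<open>For each \<open>w\<close> the argument \<open>d k *\<^sub>R w\<close> tends to 0, where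
  the autocorrelation is the squared norm of \<open>f\<close>. \<open>norm_autocorr_le\<close>
  supplies the dominating function, and \<open>gauss\<close> has mass 1.\<close>

lemma gauss_autocorr_tendsto:
  fixes f :: "'a::euclidean_space \<Rightarrow> complex"
  assumes f[measurable]: "f \<in> borel_measurable borel" and i: "integrable lborel (\<lambda>x. (norm (f x))\<^sup>2)"
    and B: "\<And>x. norm x > B \<Longrightarrow> f x = 0" and d: "d \<longlonglongrightarrow> 0"
  shows "(\<lambda>k. LBINT w. gauss w * Re (autocorr f (d k *\<^sub>R w))) \<longlonglongrightarrow> (LBINT x. (norm (f x))\<^sup>2)"
proof -
  let ?I = "LBINT x. (norm (f x))\<^sup>2"
  have "(\<lambda>k. LBINT w::'a. gauss w * Re (autocorr f (d k *\<^sub>R w))) \<longlonglongrightarrow> (LBINT w::'a. gauss w * ?I)"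
  proof (rule integral_dominated_convergence[where w = "\<lambda>w. gauss w * ?I"])
    show "integrable lborel (\<lambda>w::'a. gauss w * ?I)" using integrable_gauss[where 'a='a] by simp
    show "AE w in lborel. (\<lambda>k. gauss w * Re (autocorr f (d k *\<^sub>R w))) \<longlonglongrightarrow> gauss w * ?I"
    proof (rule AE_I2)
      fix w :: 'a
      have "(\<lambda>k. d k *\<^sub>R w) \<longlonglongrightarrow> 0 *\<^sub>R w" using d by (intro tendsto_intros)
      then have "(\<lambda>k. d k *\<^sub>R w) \<longlonglongrightarrow> 0" by simp
      then have "(\<lambda>k. LBINT x. (norm (f x - f (x - d k *\<^sub>R w)))\<^sup>2) \<longlonglongrightarrow> 0"
        by (intro translation_tendsto[where B = B, OF f i] B)
      then have "(\<lambda>k. ?I - (LBINT x. (norm (f x - f (x - d k *\<^sub>R w)))\<^sup>2) / 2) \<longlonglongrightarrow> ?I - 0 / 2"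
        by (intro tendsto_diff tendsto_divide tendsto_const) auto
      then show "(\<lambda>k. gauss w * Re (autocorr f (d k *\<^sub>R w))) \<longlonglongrightarrow> gauss w * ?I"
        by (intro tendsto_intros) (simp add: Re_autocorr[OF f i])
    qed
    show "AE w::'a in lborel. norm (gauss w * Re (autocorr f (d k *\<^sub>R w))) \<le> gauss w * ?I" for k
      using order_trans[OF abs_Re_le_cmod norm_autocorr_le[OF f i]]
      by (auto simp: abs_mult gauss_nonneg intro!: mult_left_mono)
  qed auto
  then show ?thesis by (simp add: integral_gauss)
qed

text \<open>The transform without its normalizing constant, taken over \<open>lborel\<close> so that
  for Borel functions the integrands on product spaces are measurable. \<open>fourier\<close> has
  the factor (2 pi)^(-n/2) and uses the completed measure.\<close>

definition ft :: "('a::euclidean_space \<Rightarrow> complex) \<Rightarrow> 'a \<Rightarrow> complex" where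
  "ft f \<xi> = (LBINT x. f x * exp (- (\<i> * complex_of_real (x \<bullet> \<xi>))))"

lemma borel_measurable_ft [measurable]:
  assumes [measurable]: "f \<in> borel_measurable borel"
  shows "ft f \<in> borel_measurable borel"
  unfolding ft_def[abs_def] by measurable

lemma integrable_mult_iexp:
  fixes f :: "'a::euclidean_space \<Rightarrow> complex"
  assumes "integrable lborel f"
  shows "integrable lborel (\<lambda>x. f x * exp (- (\<i> * complex_of_real (x \<bullet> \<xi>))))"
proof (rule Bochner_Integration.integrable_bound[OF assms])
  have [measurable]: "f \<in> borel_measurable borel"
    using borel_measurable_integrable[OF assms] by simp
  show "(\<lambda>x. f x * exp (- (\<i> * complex_of_real (x \<bullet> \<xi>)))) \<in> borel_measurable lborel"
    by measurable
qed (auto simp: norm_mult)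

text \<open>For fixed \<open>x\<close> the reflection \<open>z \<mapsto> x - z\<close> turns the
  integral of \<open>norm (f (x - z))\<close> over \<open>z\<close> into the L1 norm of
  \<open>f\<close>, so the absolute double integral is the square of that norm.\<close>

lemma integrable_pair_autocorr:
  fixes f :: "'a::euclidean_space \<Rightarrow> complex"
  assumes f: "integrable lborel f"
  shows "integrable (lborel \<Otimes>\<^sub>M lborel) (\<lambda>(x, z). f x * cnj (f (x - z)))"
proof -
  have [measurable]: "f \<in> borel_measurable borel"
    using borel_measurable_integrable[OF f] by simp
  have refl: "integrable lborel (\<lambda>z. f (x - z)) \<and> (LBINT z. norm (f (x - z))) = (LBINT z. norm (f z))" for x
  proof -
    have m: "(\<lambda>z. x - z) \<in> lborel \<rightarrow>\<^sub>M borel" by measurable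
    show ?thesis
      using integrable_distr_eq[OF m, of f] integral_distr[OF m, of "\<lambda>z. norm (f z)"] f by (simp add: lborel_reflect)
  qed
  show ?thesis
  proof (rule lborel_pair.Fubini_integrable)
    show "integrable lborel (\<lambda>x. LBINT y. norm (case (x, y) of (x, z) \<Rightarrow> f x * cnj (f (x - z))))"
      using f refl by (simp add: norm_mult)
    show "AE x in lborel. integrable lborel (\<lambda>y. case (x, y) of (x, z) \<Rightarrow> f x * cnj (f (x - z)))"
      using refl by auto
  qed measurable
qed

lemma integrable_autocorr:
  assumes "integrable lborel f"
  shows "integrable lborel (autocorr f)"
  unfolding autocorr_def[abs_def]
  using lborel_pair.integrable_snd[OF integrable_pair_autocorr[OF assms]] .

text \<open>\<open>autocorr f\<close> is the convolution of \<open>f\<close> with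
  \<open>y \<mapsto> cnj (f (- y))\<close>, so this is an instance of the convolution theorem: the
  character splits as in \<open>e_diff\<close>, and after exchanging integrals the inner one is the
  conjugate of \<open>ft f \<xi>\<close>.\<close>

lemma ft_autocorr:
  fixes f :: "'a::euclidean_space \<Rightarrow> complex"
  assumes f: "integrable lborel f"
  shows "ft (autocorr f) \<xi> = complex_of_real ((norm (ft f \<xi>))\<^sup>2)"
proof -
  have [measurable]: "f \<in> borel_measurable borel"
    using borel_measurable_integrable[OF f] by simp
  define e where "e x = exp (- (\<i> * complex_of_real (x \<bullet> \<xi>)))" for x
  have [measurable]: "e \<in> borel_measurable borel" unfolding e_def by measurable
  have ne: "norm (e x) = 1" for x by (simp add: e_def)
  have e_diff: "e z = e x * cnj (e (x - z))" for x z
    unfolding e_def exp_cnj exp_add[symmetric]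
    by (rule arg_cong[where f = exp]) (simp add: inner_diff_left algebra_simps)
  have int: "integrable (lborel \<Otimes>\<^sub>M lborel) (\<lambda>(x, z). f x * cnj (f (x - z)) * e z)"
    by (rule Bochner_Integration.integrable_bound[OF integrable_pair_autocorr[OF f]])
       (auto simp: norm_mult ne)
  have refl: "(LBINT z. h (x - z)) = (LBINT z. h z)"
    if [measurable]: "h \<in> borel_measurable borel" for h :: "'a \<Rightarrow> complex" and x
  proof -
    have m: "(\<lambda>z. x - z) \<in> lborel \<rightarrow>\<^sub>M borel" by measurable
    show ?thesis
      using integral_distr[OF m, of h] by (simp add: lborel_reflect)
  qed
  have "ft (autocorr f) \<xi> = (LBINT z. LBINT x. f x * cnj (f (x - z)) * e z)"
    unfolding ft_def autocorr_def e_def by simp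
  also have "\<dots> = (LBINT x. LBINT z. f x * cnj (f (x - z)) * e z)"
    using lborel_pair.Fubini_integral[OF int] by simp
  also have "\<dots> = (LBINT x. f x * e x * (LBINT z. cnj (f (x - z) * e (x - z))))"
  proof (rule Bochner_Integration.integral_cong[OF HOL.refl])
    fix x
    have "f x * cnj (f (x - z)) * e z = (f x * e x) * cnj (f (x - z) * e (x - z))" for z
      by (subst e_diff[of z x]) simp
    then show "(LBINT z. f x * cnj (f (x - z)) * e z) = f x * e x * (LBINT z. cnj (f (x - z) * e (x - z)))"
      by (simp only: integral_mult_right_zero)
  qed
  also have "\<dots> = (LBINT x. f x * e x * cnj (ft f \<xi>))"
    by (subst refl[of "\<lambda>z. cnj (f z * e z)"], measurable) (simp only: Bochner_Integration.integral_cnj ft_def e_def)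
  also have "\<dots> = ft f \<xi> * cnj (ft f \<xi>)"
    by (simp add: ft_def e_def)
  finally show ?thesis by (simp only: complex_norm_square)
qed

text \<open>The kernel is symmetric in its two variables and has modulus 1, so Fubini moves the
  transform from one factor to the other.\<close>

lemma ft_multiplication:
  fixes a b :: "'a::euclidean_space \<Rightarrow> complex"
  assumes a: "integrable lborel a" and b: "integrable lborel b"
  shows "(LBINT \<xi>. ft a \<xi> * b \<xi>) = (LBINT x. a x * ft b x)"
proof -
  have [measurable]: "a \<in> borel_measurable borel" "b \<in> borel_measurable borel"
    using borel_measurable_integrable[OF a] borel_measurable_integrable[OF b] by simp_all
  have "integrable (lborel \<Otimes>\<^sub>M lborel) (\<lambda>(x, \<xi>). a x * exp (- (\<i> * complex_of_real (x \<bullet> \<xi>))) * b \<xi>)"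
  proof (rule lborel_pair.Fubini_integrable)
    show "integrable lborel (\<lambda>x. LBINT y. norm (case (x, y) of (x, \<xi>) \<Rightarrow> a x * exp (- (\<i> * complex_of_real (x \<bullet> \<xi>))) * b \<xi>))"
      using a by (simp add: norm_mult)
    have "integrable lborel (\<lambda>\<xi>. a x * exp (- (\<i> * complex_of_real (x \<bullet> \<xi>))) * b \<xi>)" for x
      using integrable_mult_right[OF integrable_mult_iexp[OF b, of x], of "a x"]
      by (simp add: inner_commute mult_ac)
    then show "AE x in lborel. integrable lborel (\<lambda>y. case (x, y) of (x, \<xi>) \<Rightarrow> a x * exp (- (\<i> * complex_of_real (x \<bullet> \<xi>))) * b \<xi>)"
      by simp
  qed measurable
  from lborel_pair.Fubini_integral[OF this]
  have "(LBINT \<xi>. LBINT x. a x * exp (- (\<i> * complex_of_real (x \<bullet> \<xi>))) * b \<xi>) =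
    (LBINT x. LBINT \<xi>. a x * exp (- (\<i> * complex_of_real (x \<bullet> \<xi>))) * b \<xi>)" by simp
  also have "\<dots> = (LBINT x. a x * ft b x)"
    unfolding ft_def by (simp add: inner_commute mult_ac)
  finally show ?thesis by (simp add: ft_def)
qed

lemma
  fixes h :: "'a::euclidean_space \<Rightarrow> 'b::{banach, second_countable_topology}"
  assumes [measurable]: "h \<in> borel_measurable borel" and d: "0 < d"
  shows integral_lborel_scale: "(LBINT x. h x) = d ^ DIM('a) *\<^sub>R (LBINT x. h (d *\<^sub>R x))"
    and integrable_lborel_scale: "integrable lborel h \<Longrightarrow> integrable lborel (\<lambda>x. h (d *\<^sub>R x))"
proof -
  have l: "lborel = density (distr lborel borel (\<lambda>x::'a. d *\<^sub>R x)) (\<lambda>_. ennreal (d ^ DIM('a)))"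
    using lborel_affine[of d "0::'a"] d by (simp add: ennreal_power)
  show "(LBINT x. h x) = d ^ DIM('a) *\<^sub>R (LBINT x. h (d *\<^sub>R x))"
    by (subst l, subst integral_density, (use d in simp_all)[3], subst integral_distr) auto
  assume "integrable lborel h"
  then have "integrable (density (distr lborel borel (\<lambda>x::'a. d *\<^sub>R x)) (\<lambda>_. ennreal (d ^ DIM('a)))) h"
    using l by simp
  then have "integrable lborel (\<lambda>x. d ^ DIM('a) *\<^sub>R h (d *\<^sub>R x))"
    using d by (subst (asm) integrable_density) (auto simp: integrable_distr_eq)
  from integrable_scaleR_right[OF this, of "1 / d ^ DIM('a)"]
  show "integrable lborel (\<lambda>x. h (d *\<^sub>R x))" using d by simp
qed

text \<open>By \<open>ft_autocorr\<close> the squared modulus is itself a transform. The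
  multiplication formula moves that transform onto the Gaussian, which is again a Gaussian, and a
  change of scale puts \<open>d\<close> inside the autocorrelation.\<close>

lemma integral_exp_mult_ft:
  fixes f :: "'a::euclidean_space \<Rightarrow> complex"
  assumes f: "integrable lborel f" and d: "0 < d"
  shows "(LBINT \<xi>. exp (- (norm (d *\<^sub>R \<xi>))\<^sup>2 / 2) * (norm (ft f \<xi>))\<^sup>2) =
    (2 * pi) ^ DIM('a) * (LBINT w. gauss w * Re (autocorr f (d *\<^sub>R w)))"
proof -
  have [measurable]: "f \<in> borel_measurable borel"
    using borel_measurable_integrable[OF f] by simp
  let ?n = "DIM('a)"
  \<comment> \<open>This constant enters twice: once when the exponential is written as a multiple
    of \<open>gauss\<close>, once through the transform of \<open>gauss\<close>. The two together
    give the power of \<open>2 * pi\<close> in the claim.\<close>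
  define c where "c = (2 * pi) powr (real ?n / 2)"
  have c: "c > 0" "c * c = (2 * pi) ^ ?n"
    by (simp_all add: c_def powr_add[symmetric] powr_realpow)
  have exp_eq: "exp (- (norm x)\<^sup>2 / 2) = c * gauss x" for x :: 'a
    using c(1) by (simp add: gauss_def c_def powr_add[symmetric] mult.assoc[symmetric])
  define b where "b \<xi> = complex_of_real (gauss (d *\<^sub>R \<xi>))" for \<xi> :: 'a
  have ib: "integrable lborel b"
    unfolding b_def using integrable_lborel_scale[OF _ d, of "gauss :: 'a \<Rightarrow> real"] integrable_gauss[where 'a='a] by simp
  have A: "integrable lborel (autocorr f)" using f by (rule integrable_autocorr)
  have ft_b: "ft b (d *\<^sub>R w) = complex_of_real (c * gauss w / d ^ ?n)" for w
  proof -
    have "ft b (d *\<^sub>R w) = (LBINT x. complex_of_real (gauss (d *\<^sub>R x)) * exp (\<i> * complex_of_real ((d *\<^sub>R x) \<bullet> (- w))))"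
      unfolding ft_def b_def by (simp add: mult_ac)
    also have "\<dots> = (1 / d ^ ?n) *\<^sub>R (d ^ ?n *\<^sub>R \<dots>)"
      using d by simp
    also have "d ^ ?n *\<^sub>R (LBINT x. complex_of_real (gauss (d *\<^sub>R x)) * exp (\<i> * complex_of_real ((d *\<^sub>R x) \<bullet> (- w)))) =
      (LBINT x. complex_of_real (gauss x) * exp (\<i> * complex_of_real (x \<bullet> (- w))))"
      by (rule integral_lborel_scale[symmetric, OF _ d]) measurable
    also have "\<dots> = complex_of_real (c * gauss w)"
      unfolding integral_gauss_iexp norm_minus_cancel exp_eq ..
    finally show ?thesis by (simp add: scaleR_conv_of_real)
  qed
  have "complex_of_real (LBINT \<xi>. exp (- (norm (d *\<^sub>R \<xi>))\<^sup>2 / 2) * (norm (ft f \<xi>))\<^sup>2) =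
      c * (LBINT \<xi>. ft (autocorr f) \<xi> * b \<xi>)"
    unfolding ft_autocorr[OF f] b_def exp_eq
    unfolding integral_complex_of_real[symmetric] integral_mult_right_zero[symmetric]
    by (intro Bochner_Integration.integral_cong) (auto simp: mult_ac)
  also have "(LBINT \<xi>. ft (autocorr f) \<xi> * b \<xi>) = (LBINT x. autocorr f x * ft b x)"
    by (rule ft_multiplication[OF A ib])
  \<comment> \<open>Substituting \<open>x = d *\<^sub>R w\<close> produces the Jacobian that cancels
    the denominator in \<open>ft_b\<close>.\<close>
  also have "\<dots> = d ^ ?n *\<^sub>R (LBINT w. autocorr f (d *\<^sub>R w) * ft b (d *\<^sub>R w))"
    using borel_measurable_integrable[OF ib] by (intro integral_lborel_scale d) auto
  also have "(LBINT w. autocorr f (d *\<^sub>R w) * ft b (d *\<^sub>R w)) =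
      (c / d ^ ?n) *\<^sub>R (LBINT w. gauss w *\<^sub>R autocorr f (d *\<^sub>R w))"
    unfolding ft_b integral_scaleR_right[symmetric]
    by (intro Bochner_Integration.integral_cong) (auto simp: scaleR_conv_of_real)
  also have "complex_of_real c * (d ^ ?n *\<^sub>R (c / d ^ ?n) *\<^sub>R (LBINT w. gauss w *\<^sub>R autocorr f (d *\<^sub>R w))) =
      (c * c) *\<^sub>R (LBINT w. gauss w *\<^sub>R autocorr f (d *\<^sub>R w))"
    using d by (simp add: scaleR_conv_of_real)
  finally have eq: "complex_of_real (LBINT \<xi>. exp (- (norm (d *\<^sub>R \<xi>))\<^sup>2 / 2) * (norm (ft f \<xi>))\<^sup>2) =
      (c * c) *\<^sub>R (LBINT w. gauss w *\<^sub>R autocorr f (d *\<^sub>R w))" .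
  have "integrable lborel (\<lambda>w. autocorr f (d *\<^sub>R w))"
    by (rule integrable_lborel_scale[OF _ d A]) measurable
  then have "integrable lborel (\<lambda>w. gauss w *\<^sub>R autocorr f (d *\<^sub>R w))"
  proof (rule Bochner_Integration.integrable_bound[OF integrable_scaleR_right[of "(2 * pi) powr (- real DIM('a) / 2)"]])
    show "AE w in lborel. norm (gauss w *\<^sub>R autocorr f (d *\<^sub>R w)) \<le>
        norm ((2 * pi) powr (- real DIM('a) / 2) *\<^sub>R autocorr f (d *\<^sub>R w))"
      by (auto simp: gauss_def intro!: AE_I2 mult_left_le_one_le)
  qed measurable
  from integral_Re[OF this] have "Re (LBINT w. gauss w *\<^sub>R autocorr f (d *\<^sub>R w)) = (LBINT w. gauss w * Re (autocorr f (d *\<^sub>R w)))"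
    by simp
  with arg_cong[OF eq, of Re] show ?thesis by (simp add: c)
qed

text \<open>Damping by a factor of at most 1 can only decrease the integral on the right, while the
  damped integrals converge to the left-hand side as the damping parameter \<open>d k\<close> tends
  to 0.\<close>

lemma plancherel_lower:
  fixes f :: "'a::euclidean_space \<Rightarrow> complex"
  assumes f[measurable]: "f \<in> borel_measurable borel" and i: "integrable lborel (\<lambda>x. (norm (f x))\<^sup>2)"
    and B: "\<And>x. norm x > B \<Longrightarrow> f x = 0"
    and ft: "integrable lborel (\<lambda>\<xi>. (norm (ft f \<xi>))\<^sup>2)"
  shows "(2 * pi) ^ DIM('a) * (LBINT x. (norm (f x))\<^sup>2) \<le> (LBINT \<xi>. (norm (ft f \<xi>))\<^sup>2)"
proof -
  have f1: "integrable lborel f"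
  proof (rule Bochner_Integration.integrable_bound)
    show "integrable lborel (\<lambda>x. (norm (f x))\<^sup>2 + indicator (cball 0 B) x :: real)"
      by (intro Bochner_Integration.integrable_add i integrable_real_indicator)
         (auto intro: emeasure_bounded_finite[unfolded infinity_ennreal_def])
    \<comment> \<open>Bounded support turns square-integrability into integrability: the summand 1
      is only charged on the ball of radius \<open>B\<close>.\<close>
    have "norm (f x) \<le> (norm (f x))\<^sup>2 + 1" for x
      using sum_squares_bound[of "norm (f x)" 1] by (smt (verit) norm_ge_zero one_power2 mult_1_right)
    then show "AE x in lborel. norm (f x) \<le> norm ((norm (f x))\<^sup>2 + indicator (cball 0 B) x :: real)"
      using B by (auto simp: indicator_def)
  qed simp
  define d where "d k = 1 / real (Suc k)" for k
  have d0: "d \<longlonglongrightarrow> 0" unfolding d_def by (rule lim_1_over_n[THEN LIMSEQ_Suc])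
  have d_pos: "d k > 0" for k by (simp add: d_def)
  have lim: "(\<lambda>k. (2 * pi) ^ DIM('a) * (LBINT w. gauss w * Re (autocorr f (d k *\<^sub>R w)))) \<longlonglongrightarrow>
      (2 * pi) ^ DIM('a) * (LBINT x. (norm (f x))\<^sup>2)"
    by (intro tendsto_mult tendsto_const gauss_autocorr_tendsto[where B = B, OF f i _ d0] B)
  have "(2 * pi) ^ DIM('a) * (LBINT w. gauss w * Re (autocorr f (d k *\<^sub>R w))) \<le> (LBINT \<xi>. (norm (ft f \<xi>))\<^sup>2)" for k
  proof -
    have le: "exp (- (norm (d k *\<^sub>R \<xi>))\<^sup>2 / 2) * (norm (ft f \<xi>))\<^sup>2 \<le> (norm (ft f \<xi>))\<^sup>2" for \<xi>
      by (intro mult_left_le_one_le) auto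
    have "(LBINT \<xi>. exp (- (norm (d k *\<^sub>R \<xi>))\<^sup>2 / 2) * (norm (ft f \<xi>))\<^sup>2) \<le> (LBINT \<xi>. (norm (ft f \<xi>))\<^sup>2)"
    proof (intro integral_mono le ft)
      show "integrable lborel (\<lambda>\<xi>. exp (- (norm (d k *\<^sub>R \<xi>))\<^sup>2 / 2) * (norm (ft f \<xi>))\<^sup>2)"
        by (rule Bochner_Integration.integrable_bound[OF ft]) (use le in auto)
    qed
    then show ?thesis unfolding integral_exp_mult_ft[OF f1 d_pos] .
  qed
  then show ?thesis by (intro LIMSEQ_le_const2[OF lim]) auto
qed

subsection \<open>The symbol and the bathtub principle\<close>

text \<open>Polar coordinates for radial integrands. Restriction to a ball keeps the masses of
  half-lines finite, so agreement on open half-lines is enough: one side is the volume of a shell,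
  the other the integral of the derivative of \<open>?w * r ^ ?n\<close>.\<close>

lemma distr_norm_cball:
  assumes R: "0 < R"
  shows "distr (density lborel (indicator (cball (0::'a::euclidean_space) R))) borel norm =
    density lborel (\<lambda>r. ennreal (real DIM('a) * unit_ball_vol (real DIM('a)) * r ^ (DIM('a) - 1) * indicator {0..R} r))"
    (is "?M = ?N")
proof (rule measure_eqI_lessThan)
  let ?n = "DIM('a)" and ?w = "unit_ball_vol (real DIM('a))"
  have w: "0 \<le> ?w" by simp
  have [measurable]: "cball (0::'a) R \<in> sets borel" by simp
  \<comment> \<open>Clamping \<open>x\<close> to the interval from 0 to \<open>R\<close> covers
    half-lines starting below 0 (the whole ball) and beyond \<open>R\<close> (nothing).\<close>
  have M: "emeasure ?M {x<..} = ennreal (?w * R ^ ?n - ?w * (min R (max 0 x)) ^ ?n)" for x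
  proof -
    have "emeasure ?M {x<..} = emeasure lborel (cball (0::'a) R \<inter> {v. x < norm v})"
      by (subst emeasure_distr, simp, simp, subst emeasure_density)
         (auto simp: vimage_def indicator_inter_arith simp flip: nn_integral_indicator
           intro!: nn_integral_cong split: split_indicator)
    also have "\<dots> = ennreal (?w * R ^ ?n - ?w * (min R (max 0 x)) ^ ?n)"
    proof (cases "x < 0")
      case True
      then have "cball (0::'a) R \<inter> {v. x < norm v} = cball 0 R"
        by (auto intro: less_le_trans[OF _ norm_ge_zero])
      then show ?thesis using True R by (simp add: emeasure_cball)
    next
      case False
      have "cball (0::'a) R \<inter> {v. x < norm v} = cball 0 R - cball 0 (min R x)" by auto
      also have "emeasure lborel \<dots> = emeasure lborel (cball (0::'a) R) - emeasure lborel (cball (0::'a) (min R x))"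
        using R False by (intro emeasure_Diff) (auto simp: emeasure_cball)
      also have "\<dots> = ennreal (?w * R ^ ?n - ?w * (min R x) ^ ?n)"
        using R False w by (subst (1 2) emeasure_cball) (auto simp: ennreal_minus)
      finally show ?thesis using False by (simp add: max_def)
    qed
    finally show ?thesis .
  qed
  show "emeasure ?M {x<..} < \<infinity>" for x unfolding M by simp
  show "emeasure ?M {x<..} = emeasure ?N {x<..}" for x
  proof -
    define y where "y = min R (max 0 x)"
    have y: "0 \<le> y" "y \<le> R" using R by (auto simp: y_def)
    have "emeasure ?N {x<..} = (\<integral>\<^sup>+r. ennreal (real ?n * ?w * r ^ (?n - 1)) * indicator {y..R} r \<partial>lborel)"
      unfolding emeasure_density[of _ lborel, simplified]
    proof (subst emeasure_density, measurable, rule nn_integral_cong_AE)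
      \<comment> \<open>The half-line is open and the interval closed, so the integrands can differ
        only at an endpoint.\<close>
      have "AE r in lborel. r \<noteq> y" by (rule AE_lborel_singleton)
      moreover have "AE r in lborel. r \<noteq> R" by (rule AE_lborel_singleton)
      ultimately show "AE r in lborel. ennreal (real ?n * ?w * r ^ (?n - 1) * indicator {0..R} r) * indicator {x<..} r =
        ennreal (real ?n * ?w * r ^ (?n - 1)) * indicator {y..R} r"
        by eventually_elim (auto simp: y_def indicator_def min_def max_def split: if_splits)
    qed
    also have "\<dots> = ennreal (?w * R ^ ?n - ?w * y ^ ?n)"
    proof (rule nn_integral_FTC_Icc)
      show "((\<lambda>r. ?w * r ^ ?n) has_real_derivative real ?n * ?w * r ^ (?n - 1)) (at r)" for r
        by (auto intro!: derivative_eq_intros)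
      show "0 \<le> real ?n * ?w * r ^ (?n - 1)" if "r \<in> {y..R}" for r
        using that y w by (intro mult_nonneg_nonneg zero_le_power) auto
    qed (use y in auto)
    finally show ?thesis unfolding M y_def by simp
  qed
qed auto

lemma integral_radial_cball:
  fixes g :: "real \<Rightarrow> real"
  assumes [measurable]: "g \<in> borel_measurable borel" and R: "0 < R"
  shows "(LBINT x::'a::euclidean_space. indicator (cball 0 R) x * g (norm x)) =
    real DIM('a) * unit_ball_vol (real DIM('a)) * (LBINT r. indicator {0..R} r * (r ^ (DIM('a) - 1) * g r))"
proof -
  let ?n = "DIM('a)" and ?w = "unit_ball_vol (real DIM('a))"
  have [measurable]: "cball (0::'a) R \<in> sets borel" by simp
  have "(LBINT x::'a. indicator (cball 0 R) x * g (norm x)) =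
      integral\<^sup>L (density lborel (\<lambda>x::'a. ennreal (indicator (cball 0 R) x))) (\<lambda>x. g (norm x))"
    by (subst integral_real_density) auto
  also have "\<dots> = integral\<^sup>L (distr (density lborel (indicator (cball (0::'a) R))) borel norm) g"
    by (subst integral_distr) (auto simp: ennreal_indicator)
  also have "\<dots> = (LBINT r. real ?n * ?w * r ^ (?n - 1) * indicator {0..R} r * g r)"
    unfolding distr_norm_cball[OF R]
    by (subst integral_real_density) (auto intro!: AE_I2 mult_nonneg_nonneg split: split_indicator)
  also have "\<dots> = (LBINT r. (real ?n * ?w) * (indicator {0..R} r * (r ^ (?n - 1) * g r)))"
    by (simp add: mult_ac)
  finally show ?thesis by simp
qed

text \<open>Only the point 0 is delicate: the limit there is 0, which is also the value because
  \<open>0 powr a = 0\<close>.\<close>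

lemma continuous_on_powr_ln:
  fixes a R :: real
  assumes a: "0 < a" and R: "0 < R"
  shows "continuous_on {0..R} (\<lambda>r. r powr a * ln r)"
  unfolding continuous_on_eq_continuous_within
proof
  fix r assume r: "r \<in> {0..R}"
  show "continuous (at r within {0..R}) (\<lambda>r. r powr a * ln r)"
  proof (cases "r = 0")
    case True
    have "((\<lambda>r::real. r powr a * ln r) \<longlongrightarrow> 0) (at_right 0)"
      using a by real_asymp
    then show ?thesis
      using True R by (simp add: continuous_within at_within_Icc_at_right)
  next
    case False
    then show ?thesis using r by (intro continuous_intros) auto
  qed
qed

text \<open>Integration by parts gives the antiderivative \<open>F\<close>, continuous down to
  \<open>F 0 = 0\<close>. With \<open>1 < a\<close> the exponent \<open>a - 1\<close> is positive,
  so the integrand is continuous on the closed interval.\<close>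

lemma integral_powr_ln:
  fixes a R :: real
  assumes a: "1 < a" and R: "0 < R"
  shows "(LBINT r. indicator {0..R} r * (r powr (a - 1) * ln r)) = R powr a * (ln R / a - 1 / a\<^sup>2)"
proof -
  define F where "F r = r powr a * ln r / a - r powr a / a\<^sup>2" for r :: real
  have "((\<lambda>r. r powr (a - 1) * ln r) has_integral F R - F 0) {0..R}"
  proof (rule fundamental_theorem_of_calculus_interior)
    show "continuous_on {0..R} F"
      unfolding F_def using a R
      by (intro continuous_intros continuous_on_powr_ln continuous_on_powr') auto
    fix r assume r: "r \<in> {0<..<R}"
    have "(F has_real_derivative r powr (a - 1) * ln r) (at r)"
      unfolding F_def using a r
      by (auto intro!: derivative_eq_intros simp: field_simps power2_eq_square powr_diff)
    then show "(F has_vector_derivative r powr (a - 1) * ln r) (at r)"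
      by (simp add: has_real_derivative_iff_has_vector_derivative)
  qed (use R in auto)
  moreover have "set_integrable lborel {0..R} (\<lambda>r. r powr (a - 1) * ln r)"
    unfolding set_integrable_def
    using continuous_on_powr_ln[of "a - 1" R] a R by (intro borel_integrable_compact) auto
  ultimately have "(LINT r:{0..R}|lborel. r powr (a - 1) * ln r) = F R - F 0"
    by (metis set_borel_integral_eq_integral(2) integral_unique)
  then show ?thesis
    by (simp add: set_lebesgue_integral_def F_def field_simps)
qed


section \<open>Comparison of symbol values and integrals over balls\<close>

lemma borel_measurable_fraclog_symbol [measurable]: "fraclog_symbol s \<in> borel_measurable borel"
  unfolding fraclog_symbol_def[abs_def] by measurable

lemma fraclog_symbol_radial: "fraclog_symbol s \<xi> = 2 * (norm \<xi> powr (2 * s) * ln (norm \<xi>))"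
  by (cases "\<xi> = 0") (auto simp: fraclog_symbol_def ln_realpow)

text \<open>The symbol is not monotone in the radius near 0, but it is at most 0 on the unit ball
  and nonnegative and increasing outside. Comparison therefore works once the larger radius is at
  least 1.\<close>

lemma fraclog_symbol_mono:
  assumes "0 < s" "1 \<le> norm \<eta>" "norm \<xi> \<le> norm \<eta>"
  shows "fraclog_symbol s \<xi> \<le> fraclog_symbol s \<eta>"
proof (cases "norm \<xi> \<le> 1")
  case True
  then have "norm \<xi> powr (2 * s) * ln (norm \<xi>) \<le> 0"
    by (cases "\<xi> = 0") (auto intro!: mult_nonneg_nonpos)
  moreover have "0 \<le> norm \<eta> powr (2 * s) * ln (norm \<eta>)"
    using assms by (intro mult_nonneg_nonneg) auto
  ultimately show ?thesis unfolding fraclog_symbol_radial by linarith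
next
  case False
  then have "norm \<xi> powr (2 * s) * ln (norm \<xi>) \<le> norm \<eta> powr (2 * s) * ln (norm \<eta>)"
    using assms by (intro mult_mono powr_mono2 ln_mono) auto
  then show ?thesis unfolding fraclog_symbol_radial by simp
qed

lemma fraclog_symbol_bounded_cball:
  assumes s: "0 < s" and R: "0 < R"
  obtains C where "\<And>\<xi>. norm \<xi> \<le> R \<Longrightarrow> \<bar>fraclog_symbol s \<xi>\<bar> \<le> C"
proof -
  have "bounded ((\<lambda>r. r powr (2 * s) * ln r) ` {0..R})"
    using s R by (intro compact_imp_bounded compact_continuous_image continuous_on_powr_ln) auto
  then obtain K where "\<And>r. r \<in> {0..R} \<Longrightarrow> \<bar>r powr (2 * s) * ln r\<bar> \<le> K"
    unfolding bounded_iff real_norm_def by blast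
  then have "\<bar>fraclog_symbol s \<xi>\<bar> \<le> 2 * K" if "norm \<xi> \<le> R" for \<xi>
    using that unfolding fraclog_symbol_radial by (simp add: abs_mult)
  then show thesis by (rule that)
qed

text \<open>In polar coordinates the Jacobian and the power in the symbol combine to the exponent
  \<open>a - 1\<close> of \<open>integral_powr_ln\<close> with \<open>a\<close> = n + 2s. The
  leading 2 comes from the square inside the logarithm.\<close>

lemma
  fixes s R :: real
  assumes s: "0 < s" and R: "0 < R"
  shows integrable_fraclog_symbol_cball:
      "integrable lborel (\<lambda>\<xi>::real^'n. indicator (cball 0 R) \<xi> * fraclog_symbol s \<xi>)"
    and integral_fraclog_symbol_cball:
      "(LBINT \<xi>::real^'n. indicator (cball 0 R) \<xi> * fraclog_symbol s \<xi>) =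
        2 * real CARD('n) * unit_ball_vol (real CARD('n)) * (R powr (real CARD('n) + 2 * s) *
          (ln R / (real CARD('n) + 2 * s) - 1 / (real CARD('n) + 2 * s)\<^sup>2))"
proof -
  let ?n = "CARD('n)" and ?w = "unit_ball_vol (real CARD('n))"
  have [measurable]: "cball (0::real^'n) R \<in> sets borel" by simp
  obtain C where C: "\<And>\<xi>::real^'n. norm \<xi> \<le> R \<Longrightarrow> \<bar>fraclog_symbol s \<xi>\<bar> \<le> C"
    using fraclog_symbol_bounded_cball[OF s R] by blast
  have "0 \<le> C" using C[of 0] R by (auto intro: order_trans[OF abs_ge_zero])
  show "integrable lborel (\<lambda>\<xi>::real^'n. indicator (cball 0 R) \<xi> * fraclog_symbol s \<xi>)"
  proof (rule integrable_bounded_support_lborel[where C = C and B = R])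
    show "norm (indicator (cball 0 R) \<xi> * fraclog_symbol s \<xi>) \<le> C" for \<xi> :: "real^'n"
      using C[of \<xi>] \<open>0 \<le> C\<close> by (auto simp: indicator_def)
  qed auto
  have "(LBINT \<xi>::real^'n. indicator (cball 0 R) \<xi> * fraclog_symbol s \<xi>) =
      2 * (LBINT \<xi>::real^'n. indicator (cball 0 R) \<xi> * (norm \<xi> powr (2 * s) * ln (norm \<xi>)))"
    unfolding fraclog_symbol_radial by (subst integral_mult_right_zero[symmetric]) (simp add: mult_ac)
  also have "\<dots> = 2 * (real ?n * ?w * (LBINT r. indicator {0..R} r * (r ^ (?n - 1) * (r powr (2 * s) * ln r))))"
    by (subst integral_radial_cball[OF _ R, of "\<lambda>r. r powr (2 * s) * ln r"]) auto
  also have "(LBINT r. indicator {0..R} r * (r ^ (?n - 1) * (r powr (2 * s) * ln r))) =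
      (LBINT r. indicator {0..R} r * (r powr ((real ?n + 2 * s) - 1) * ln r))"
  proof (rule Bochner_Integration.integral_cong[OF refl])
    fix r :: real
    have "r ^ (?n - 1) * r powr (2 * s) = r powr ((real ?n + 2 * s) - 1)" if "0 < r"
    proof -
      have "r ^ (?n - 1) = r powr (real ?n - 1)"
        using that powr_realpow[of r "?n - 1"] by (simp add: of_nat_diff Suc_leI)
      then show ?thesis by (simp add: powr_add[symmetric] algebra_simps)
    qed
    \<comment> \<open>At \<open>r = 0\<close> both sides vanish since \<open>0 powr _ = 0\<close>,
      even in dimension 1, where the power \<open>r ^ 0\<close> is 1.\<close>
    then show "indicator {0..R} r * (r ^ (?n - 1) * (r powr (2 * s) * ln r)) =
      indicator {0..R} r * (r powr ((real ?n + 2 * s) - 1) * ln r)"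
      by (cases "r = 0") (auto simp: indicator_def)
  qed
  also have "\<dots> = R powr (real ?n + 2 * s) * (ln R / (real ?n + 2 * s) - 1 / (real ?n + 2 * s)\<^sup>2)"
  proof (rule integral_powr_ln[OF _ R])
    have "1 \<le> real ?n" by (simp add: Suc_leI)
    then show "1 < real ?n + 2 * s" using s by linarith
  qed
  finally show "(LBINT \<xi>::real^'n. indicator (cball 0 R) \<xi> * fraclog_symbol s \<xi>) =
        2 * real CARD('n) * unit_ball_vol (real CARD('n)) * (R powr (real CARD('n) + 2 * s) *
          (ln R / (real CARD('n) + 2 * s) - 1 / (real CARD('n) + 2 * s)\<^sup>2))" by simp
qed

lemma fraclog_bathtub_negative_part:
  fixes F :: "real^'n \<Rightarrow> real"
  assumes s: "0 < s" and F: "\<And>\<xi>. 0 \<le> F \<xi>" "\<And>\<xi>. F \<xi> \<le> M"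
    and i: "integrable lborel (\<lambda>\<xi>. fraclog_symbol s \<xi> * F \<xi>)"
  shows "M * (LBINT \<xi>::real^'n. indicator (cball 0 1) \<xi> * fraclog_symbol s \<xi>) \<le>
    (LBINT \<xi>. fraclog_symbol s \<xi> * F \<xi>)"
proof -
  \<comment> \<open>On the unit ball the symbol is at most 0, so replacing \<open>F\<close> by its
    upper bound decreases the product; outside it is nonnegative, so \<open>F\<close> may be
    replaced by 0.\<close>
  have "M * (indicator (cball 0 1) \<xi> * fraclog_symbol s \<xi>) \<le> fraclog_symbol s \<xi> * F \<xi>" for \<xi> :: "real^'n"
  proof (cases "norm \<xi> \<le> 1")
    case True
    then have "fraclog_symbol s \<xi> \<le> 0"
      using mult_nonneg_nonpos[of "norm \<xi> powr (2 * s)" "ln (norm \<xi>)"]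
      unfolding fraclog_symbol_radial by (cases "\<xi> = 0") (auto simp: mult.commute)
    then show ?thesis
      using True mult_left_mono_neg[OF F(2)[of \<xi>], of "fraclog_symbol s \<xi>"] by (auto simp: mult.commute[of _ "fraclog_symbol s \<xi>"])
  next
    case False
    then show ?thesis using F(1)[of \<xi>] by (simp add: fraclog_symbol_radial)
  qed
  then have "(LBINT \<xi>::real^'n. M * (indicator (cball 0 1) \<xi> * fraclog_symbol s \<xi>)) \<le>
    (LBINT \<xi>. fraclog_symbol s \<xi> * F \<xi>)"
    using integrable_fraclog_symbol_cball[OF s, of 1, where 'n = 'n] by (intro integral_mono i integrable_mult_right) auto
  then show ?thesis by simp
qed

text \<open>The value \<open>t\<close> of the symbol on the sphere of radius \<open>R\<close> acts
  as a Lagrange multiplier. It is nonnegative because \<open>1 \<le> R\<close>, so a lower bound on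
  the mass of \<open>F\<close> suffices.\<close>

lemma fraclog_bathtub:
  fixes F :: "real^'n \<Rightarrow> real"
  assumes s: "0 < s" and R: "1 \<le> R" and F: "\<And>\<xi>. 0 \<le> F \<xi>" "\<And>\<xi>. F \<xi> \<le> M"
    and iF: "integrable lborel F" and i: "integrable lborel (\<lambda>\<xi>. fraclog_symbol s \<xi> * F \<xi>)"
    and mass: "M * measure lborel (cball (0::real^'n) R) \<le> (LBINT \<xi>. F \<xi>)"
  shows "M * (LBINT \<xi>::real^'n. indicator (cball 0 R) \<xi> * fraclog_symbol s \<xi>) \<le>
    (LBINT \<xi>. fraclog_symbol s \<xi> * F \<xi>)"
proof -
  obtain \<eta> :: "real^'n" where \<eta>: "norm \<eta> = R"
    using vector_choose_size[of R] R by auto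
  define t where "t = fraclog_symbol s \<eta>"
  have t: "0 \<le> t"
    using R \<eta> by (simp add: t_def fraclog_symbol_radial)
  let ?I = "indicator (cball 0 R) :: real^'n \<Rightarrow> real"
  have i1: "integrable lborel ?I"
    by (intro integrable_real_indicator) (auto intro: emeasure_bounded_finite[unfolded infinity_ennreal_def])
  have i2: "integrable lborel (\<lambda>\<xi>::real^'n. ?I \<xi> * fraclog_symbol s \<xi>)"
    using integrable_fraclog_symbol_cball[OF s, of R, where 'n = 'n] R by simp
  \<comment> \<open>This says that
    \<open>(fraclog_symbol s \<xi> - t) * (F \<xi> - M * ?I \<xi>)\<close> is nonnegative: both
    factors are at most 0 inside the ball and at least 0 outside.\<close>
  have le: "M * (?I \<xi> * fraclog_symbol s \<xi>) + (t * F \<xi> - t * M * ?I \<xi>) \<le> fraclog_symbol s \<xi> * F \<xi>" for \<xi>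
  proof (cases "norm \<xi> \<le> R")
    case True
    then have "fraclog_symbol s \<xi> \<le> t"
      unfolding t_def using s R \<eta> by (intro fraclog_symbol_mono) auto
    then have "0 \<le> (t - fraclog_symbol s \<xi>) * (M - F \<xi>)"
      using F(2)[of \<xi>] by (intro mult_nonneg_nonneg) auto
    then show ?thesis using True by (simp add: algebra_simps)
  next
    case False
    then have "t \<le> fraclog_symbol s \<xi>"
      unfolding t_def using s R \<eta> by (intro fraclog_symbol_mono) auto
    then have "t * F \<xi> \<le> fraclog_symbol s \<xi> * F \<xi>"
      using F(1) by (rule mult_right_mono)
    then show ?thesis using False by simp
  qed
  have "(LBINT \<xi>. M * (?I \<xi> * fraclog_symbol s \<xi>) + (t * F \<xi> - t * M * ?I \<xi>)) \<le> (LBINT \<xi>. fraclog_symbol s \<xi> * F \<xi>)"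
    by (intro integral_mono le i Bochner_Integration.integrable_add Bochner_Integration.integrable_diff integrable_mult_right i1 i2 iF)
  also have "(LBINT \<xi>. M * (?I \<xi> * fraclog_symbol s \<xi>) + (t * F \<xi> - t * M * ?I \<xi>)) =
    M * (LBINT \<xi>. ?I \<xi> * fraclog_symbol s \<xi>) + t * ((LBINT \<xi>. F \<xi>) - M * measure lborel (cball (0::real^'n) R))"
    using i1 i2 iF by (simp add: algebra_simps)
  finally show ?thesis
    using mult_nonneg_nonneg[OF t, of "(LBINT \<xi>. F \<xi>) - M * measure lborel (cball (0::real^'n) R)"] mass by linarith
qed

subsection \<open>Bessel's inequality and the eigenvalue sums\<close>

lemma L2_integrable_mult_cnj:
  assumes f: "f \<in> L2 M" and g: "g \<in> L2 M"
  shows "integrable M (\<lambda>x. f x * cnj (g x))"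
proof (rule Bochner_Integration.integrable_bound)
  have [measurable]: "f \<in> borel_measurable M" "g \<in> borel_measurable M"
    using f g by (auto simp: L2_def)
  show "(\<lambda>x. f x * cnj (g x)) \<in> borel_measurable M" by measurable
  show "integrable M (\<lambda>x. ((cmod (f x))\<^sup>2 + (cmod (g x))\<^sup>2) / 2)"
    using f g by (simp add: L2_def)
  have "cmod (f x * cnj (g x)) \<le> ((cmod (f x))\<^sup>2 + (cmod (g x))\<^sup>2) / 2" for x
    using sum_squares_bound[of "cmod (f x)" "cmod (g x)"] by (simp add: norm_mult)
  then show "AE x in M. cmod (f x * cnj (g x)) \<le> norm (((cmod (f x))\<^sup>2 + (cmod (g x))\<^sup>2) / 2)"
    by (auto intro: order_trans[OF _ abs_ge_self])
qed

lemma L2_cmult: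
  assumes "f \<in> L2 M" shows "(\<lambda>x. c * f x) \<in> L2 M"
  using assms by (auto simp: L2_def norm_mult power_mult_distrib)

lemma L2_diff:
  assumes "f \<in> L2 M" "g \<in> L2 M" shows "(\<lambda>x. f x - g x) \<in> L2 M"
  using assms by (auto simp: L2_def intro: integrable_power2_norm_diff)

text \<open>Projections are removed one at a time. Each removal lowers the squared norm of the
  remainder by exactly the squared modulus of a coefficient, and the final remainder has nonnegative
  squared norm.\<close>

lemma L2_bessel:
  fixes \<phi> :: "nat \<Rightarrow> 'a \<Rightarrow> complex"
  assumes \<phi>: "\<And>j. 1 \<le> j \<Longrightarrow> \<phi> j \<in> L2 M"
    and on: "\<And>i j. 1 \<le> i \<Longrightarrow> 1 \<le> j \<Longrightarrow> L2_inner M (\<phi> i) (\<phi> j) = (if i = j then 1 else 0)"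
    and e: "e \<in> L2 M"
  shows "(\<Sum>j=1..k. (cmod (L2_inner M e (\<phi> j)))\<^sup>2) \<le> (LINT x|M. (cmod (e x))\<^sup>2)"
proof -
  define r where "r k x = e x - (\<Sum>j=1..k. L2_inner M e (\<phi> j) * \<phi> j x)" for k :: nat and x
  have r_Suc: "r (Suc k) = (\<lambda>x. r k x - L2_inner M e (\<phi> (Suc k)) * \<phi> (Suc k) x)" for k
    by (simp add: r_def fun_eq_iff)
  \<comment> \<open>The invariant also records that coefficients against later members are
    unchanged; the next step needs this for its cross term.\<close>
  have "r k \<in> L2 M \<and> (\<forall>j>k. L2_inner M (r k) (\<phi> j) = L2_inner M e (\<phi> j)) \<and>
    (LINT x|M. (cmod (r k x))\<^sup>2) = (LINT x|M. (cmod (e x))\<^sup>2) - (\<Sum>j=1..k. (cmod (L2_inner M e (\<phi> j)))\<^sup>2)"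
  proof (induction k)
    case 0
    then show ?case using e by (simp add: r_def)
  next
    case (Suc k)
    define c where "c = L2_inner M e (\<phi> (Suc k))"
    define p where "p = \<phi> (Suc k)"
    have p: "p \<in> L2 M" using \<phi> by (simp add: p_def)
    have rk: "r k \<in> L2 M" using Suc by blast
    have r': "r (Suc k) = (\<lambda>x. r k x - c * p x)" by (simp add: r_Suc c_def p_def)
    have L: "r (Suc k) \<in> L2 M"
      unfolding r' by (intro L2_diff L2_cmult rk p)
    have orth: "L2_inner M (r (Suc k)) (\<phi> j) = L2_inner M e (\<phi> j)" if j: "j > Suc k" for j
    proof -
      have i1: "integrable M (\<lambda>x. r k x * cnj (\<phi> j x))" "integrable M (\<lambda>x. p x * cnj (\<phi> j x))"
        using j by (auto intro!: L2_integrable_mult_cnj rk p \<phi>)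
      have "L2_inner M (r (Suc k)) (\<phi> j) = (LINT x|M. r k x * cnj (\<phi> j x) - c * (p x * cnj (\<phi> j x)))"
        unfolding L2_inner_def r' by (simp add: algebra_simps)
      also have "\<dots> = L2_inner M (r k) (\<phi> j) - c * L2_inner M p (\<phi> j)"
        using i1 by (simp add: L2_inner_def)
      also have "L2_inner M p (\<phi> j) = 0" unfolding p_def using on[of "Suc k" j] j by simp
      finally show ?thesis using Suc j by simp
    qed
    have ip: "integrable M (\<lambda>x. r k x * cnj (p x))"
      by (rule L2_integrable_mult_cnj[OF rk p])
    have c: "(LINT x|M. r k x * cnj (p x)) = c"
      using Suc by (simp add: L2_inner_def c_def p_def)
    have "complex_of_real (LINT x|M. (cmod (p x))\<^sup>2) = L2_inner M p p"
      unfolding L2_inner_def by (simp only: complex_norm_square[symmetric] integral_complex_of_real)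
    then have p1: "(LINT x|M. (cmod (p x))\<^sup>2) = 1"
      using on[of "Suc k" "Suc k"] unfolding p_def by simp
    \<comment> \<open>After integration the cross term contributes -2|c|^2 and the last term |c|^2,
      a net loss of |c|^2.\<close>
    have pt: "(cmod (r k x - c * p x))\<^sup>2 =
        (cmod (r k x))\<^sup>2 - 2 * Re (cnj c * (r k x * cnj (p x))) + (cmod c)\<^sup>2 * (cmod (p x))\<^sup>2" for x
      unfolding cmod_power2 by (simp add: power2_eq_square algebra_simps)
    define q where "q x = Re (cnj c * (r k x * cnj (p x)))" for x
    have iq: "integrable M (\<lambda>x. cnj c * (r k x * cnj (p x)))" using ip by (rule integrable_mult_right)
    have "integrable M q" unfolding q_def[abs_def] using iq by (rule integrable_Re)
    moreover have "(LINT x|M. q x) = (cmod c)\<^sup>2"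
    proof -
      have "(LINT x|M. q x) = Re (cnj c * c)"
        unfolding q_def integral_Re[OF iq] integral_mult_right_zero c ..
      then show ?thesis unfolding cmod_power2 by (simp add: power2_eq_square)
    qed
    moreover have "integrable M (\<lambda>x. (cmod (r k x))\<^sup>2)" "integrable M (\<lambda>x. (cmod (p x))\<^sup>2)"
      using rk p by (auto simp: L2_def)
    ultimately have "(LINT x|M. (cmod (r (Suc k) x))\<^sup>2) = (LINT x|M. (cmod (r k x))\<^sup>2) - (cmod c)\<^sup>2"
      unfolding r' pt q_def[symmetric] by (simp add: p1)
    then show ?case using Suc L orth by (simp add: c_def)
  qed
  then show ?thesis
    using Bochner_Integration.integral_nonneg[of M "\<lambda>x. (cmod (r k x))\<^sup>2"] by simp
qed

text \<open>Real and imaginary parts have Borel versions. Multiplying by the indicator of a ball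
  containing \<open>\<Omega>\<close> changes nothing almost everywhere and makes the function vanish
  everywhere outside that ball, as \<open>plancherel_lower\<close> demands.\<close>

lemma borel_representative:
  fixes u :: "'a::euclidean_space \<Rightarrow> complex"
  assumes u: "u \<in> borel_measurable lebesgue" and z: "AE x in lebesgue. x \<notin> \<Omega> \<longrightarrow> u x = 0"
    and B: "\<And>x. x \<in> \<Omega> \<Longrightarrow> norm x \<le> B"
  obtains g where "g \<in> borel_measurable borel" "AE x in lebesgue. u x = g x" "\<And>x. norm x > B \<Longrightarrow> g x = 0"
proof -
  obtain a where a: "a \<in> borel_measurable lborel" "AE x in lborel. Re (u x) = a x"
    using completion_ex_borel_measurable_real[of "\<lambda>x. Re (u x)" lborel] u by auto
  obtain b where b: "b \<in> borel_measurable lborel" "AE x in lborel. Im (u x) = b x"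
    using completion_ex_borel_measurable_real[of "\<lambda>x. Im (u x)" lborel] u by auto
  define g where "g x = indicator (cball 0 B) x * Complex (a x) (b x)" for x
  have [measurable]: "a \<in> borel_measurable borel" "b \<in> borel_measurable borel" "cball (0::'a) B \<in> sets borel"
    using a(1) b(1) by auto
  have "g \<in> borel_measurable borel"
    unfolding g_def[abs_def] Complex_eq by measurable
  moreover have "AE x in lebesgue. u x = g x"
    using AE_completion[OF a(2)] AE_completion[OF b(2)] z
  proof eventually_elim
    case (elim x)
    then have "u x = Complex (a x) (b x)" by (simp add: complex_eq_iff)
    then show ?case using elim(3) B[of x] by (auto simp: g_def indicator_def)
  qed
  moreover have "g x = 0" if "norm x > B" for x using that by (simp add: g_def)
  ultimately show thesis by (rule that)
qed

text \<open>2 exceeds the square root of e, so the logarithm of the norm is at least 1/2. Away from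
  the origin, finite energy thus controls the squared transform itself.\<close>

lemma fraclog_symbol_ge_1:
  assumes "0 < s" "2 \<le> norm \<xi>"
  shows "1 \<le> fraclog_symbol s \<xi>"
proof -
  have "(exp (1/2 :: real))\<^sup>2 = exp 1"
    unfolding exp_double[symmetric] by simp
  then have "(exp (1/2 :: real))\<^sup>2 \<le> 2\<^sup>2" using exp_le by simp
  then have "exp (1/2 :: real) \<le> 2" by (rule power2_le_imp_le) simp
  then have "1/2 \<le> ln (norm \<xi>)"
    using assms by (subst ln_ge_iff) auto
  moreover have "1 \<le> norm \<xi> powr (2 * s)"
    using assms by (intro ge_one_powr_ge_zero) auto
  ultimately have "1 * (1/2) \<le> norm \<xi> powr (2 * s) * ln (norm \<xi>)"
    by (intro mult_mono) auto
  then show ?thesis by (simp add: fraclog_symbol_radial)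
qed

lemma integral_lebesgue_eq_lborel:
  fixes f g :: "'a::euclidean_space \<Rightarrow> 'b::{banach, second_countable_topology}"
  assumes [measurable]: "g \<in> borel_measurable borel" and "f \<in> borel_measurable lebesgue"
    and "AE x in lebesgue. f x = g x"
  shows "integral\<^sup>L lebesgue f = integral\<^sup>L lborel g"
    and "integrable lebesgue f \<longleftrightarrow> integrable lborel g"
proof -
  have g: "g \<in> borel_measurable lebesgue"
    by (rule measurable_completion) simp
  have "integral\<^sup>L lebesgue f = integral\<^sup>L lebesgue g"
    using assms g by (intro integral_cong_AE) auto
  also have "\<dots> = integral\<^sup>L lborel g" by (rule integral_completion) simp
  finally show "integral\<^sup>L lebesgue f = integral\<^sup>L lborel g" .
  have "integrable lebesgue f \<longleftrightarrow> integrable lebesgue g"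
    using assms g by (intro integrable_cong_AE) auto
  also have "\<dots> \<longleftrightarrow> integrable lborel g" by (rule integrable_completion) simp
  finally show "integrable lebesgue f \<longleftrightarrow> integrable lborel g" .
qed

text \<open>The transform is bounded on the ball of radius 2, and outside it the symbol is at least
  1, so finite energy makes the transform square-integrable. Then \<open>plancherel_lower\<close>
  applies to a Borel representative.\<close>

lemma energy_space_fourier:
  fixes u :: "real^'n \<Rightarrow> complex"
  assumes u: "u \<in> energy_space s \<Omega>" and \<Omega>: "bounded \<Omega>" and s: "0 < s"
  shows borel_measurable_fourier: "fourier u \<in> borel_measurable borel"
    and integrable_fraclog_symbol_fourier: "integrable lborel (\<lambda>\<xi>. fraclog_symbol s \<xi> * (cmod (fourier u \<xi>))\<^sup>2)"
    and integrable_fourier_power2: "integrable lborel (\<lambda>\<xi>. (cmod (fourier u \<xi>))\<^sup>2)"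
    and integral_fourier_power2_ge:
      "(LINT x|lebesgue. (cmod (u x))\<^sup>2) \<le> (LBINT \<xi>. (cmod (fourier u \<xi>))\<^sup>2)"
proof -
  let ?n = "CARD('n)"
  obtain B where B: "\<And>x. x \<in> \<Omega> \<Longrightarrow> norm x \<le> B" using \<Omega> by (auto simp: bounded_iff)
  have um: "u \<in> borel_measurable lebesgue" and ui: "integrable lebesgue (\<lambda>x. (cmod (u x))\<^sup>2)"
    and uz: "AE x in lebesgue. x \<notin> \<Omega> \<longrightarrow> u x = 0"
    and ue: "integrable lebesgue (\<lambda>\<xi>. \<bar>fraclog_symbol s \<xi>\<bar> * (cmod (fourier u \<xi>))\<^sup>2)"
    using u by (auto simp: energy_space_def L2_def)
  obtain g where g[measurable]: "g \<in> borel_measurable borel" and ug: "AE x in lebesgue. u x = g x"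
    and gz: "\<And>x. norm x > B \<Longrightarrow> g x = 0"
    using borel_representative[OF um uz B] by metis
  have four: "fourier u \<xi> = complex_of_real ((2 * pi) powr (- real ?n / 2)) * ft g \<xi>" for \<xi>
  proof -
    have m: "(\<lambda>x. exp (- (\<i> * complex_of_real (x \<bullet> \<xi>)))) \<in> borel_measurable lebesgue"
      by (rule measurable_completion) simp
    have "(LINT x|lebesgue. u x * exp (- (\<i> * complex_of_real (x \<bullet> \<xi>)))) = ft g \<xi>"
      unfolding ft_def
      using ug by (intro integral_lebesgue_eq_lborel(1) borel_measurable_times um m) auto
    then show ?thesis by (simp add: fourier_def)
  qed
  have "fourier u = (\<lambda>\<xi>. complex_of_real ((2 * pi) powr (- real ?n / 2)) * ft g \<xi>)"
    using four by auto
  then show [measurable]: "fourier u \<in> borel_measurable borel" by simp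
  have abs_i: "integrable lborel (\<lambda>\<xi>. \<bar>fraclog_symbol s \<xi>\<bar> * (cmod (fourier u \<xi>))\<^sup>2)"
    using ue by (subst (asm) integrable_completion) auto
  then show "integrable lborel (\<lambda>\<xi>. fraclog_symbol s \<xi> * (cmod (fourier u \<xi>))\<^sup>2)"
    by (rule Bochner_Integration.integrable_bound) (auto simp: abs_mult)
  have g2: "integrable lborel (\<lambda>x. (cmod (g x))\<^sup>2)" "(LINT x|lebesgue. (cmod (u x))\<^sup>2) = (LBINT x. (cmod (g x))\<^sup>2)"
  proof -
    have ae: "AE x in lebesgue. (cmod (u x))\<^sup>2 = (cmod (g x))\<^sup>2" using ug by eventually_elim simp
    show "integrable lborel (\<lambda>x. (cmod (g x))\<^sup>2)" "(LINT x|lebesgue. (cmod (u x))\<^sup>2) = (LBINT x. (cmod (g x))\<^sup>2)"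
      using integral_lebesgue_eq_lborel[OF _ _ ae] ui um by auto
  qed
  have sq: "(cmod (fourier u \<xi>))\<^sup>2 = (2 * pi) powr (- real ?n) * (cmod (ft g \<xi>))\<^sup>2" for \<xi>
    by (simp add: four norm_mult power_mult_distrib power2_eq_square[of "_ powr _"] powr_add[symmetric])
  \<comment> \<open>The uniform bound on the squared transform by the L1 norm of \<open>g\<close>,
    as the exponential has modulus 1.\<close>
  define K where "K = (2 * pi) powr (- real ?n) * (LBINT x. cmod (g x))\<^sup>2"
  have K: "(cmod (fourier u \<xi>))\<^sup>2 \<le> K" for \<xi>
  proof -
    have "cmod (ft g \<xi>) \<le> (LBINT x. cmod (g x * exp (- (\<i> * complex_of_real (x \<bullet> \<xi>)))))"
      unfolding ft_def by (rule integral_norm_bound)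
    then have "cmod (ft g \<xi>) \<le> (LBINT x. cmod (g x))" by (simp add: norm_mult)
    then show ?thesis unfolding sq K_def by (intro mult_left_mono power_mono) auto
  qed
  have "0 \<le> K" unfolding K_def by simp
  show i: "integrable lborel (\<lambda>\<xi>. (cmod (fourier u \<xi>))\<^sup>2)"
  proof (rule Bochner_Integration.integrable_bound)
    show "integrable lborel (\<lambda>\<xi>::real^'n. K * indicator (cball 0 2) \<xi> + \<bar>fraclog_symbol s \<xi>\<bar> * (cmod (fourier u \<xi>))\<^sup>2)"
      by (intro Bochner_Integration.integrable_add abs_i integrable_mult_right integrable_real_indicator)
         (auto intro: emeasure_bounded_finite[unfolded infinity_ennreal_def])
    have "(cmod (fourier u \<xi>))\<^sup>2 \<le> K * indicator (cball 0 2) \<xi> + \<bar>fraclog_symbol s \<xi>\<bar> * (cmod (fourier u \<xi>))\<^sup>2" for \<xi>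
    proof (cases "norm \<xi> \<le> 2")
      case True
      then show ?thesis using K[of \<xi>] by (simp add: add_increasing2)
    next
      case False
      then show ?thesis
        using fraclog_symbol_ge_1[OF s, of \<xi>] mult_right_mono[of 1 "\<bar>fraclog_symbol s \<xi>\<bar>" "(cmod (fourier u \<xi>))\<^sup>2"] by simp
    qed
    then show "AE \<xi> in lborel. norm ((cmod (fourier u \<xi>))\<^sup>2) \<le>
      norm (K * indicator (cball 0 2) \<xi> + \<bar>fraclog_symbol s \<xi>\<bar> * (cmod (fourier u \<xi>))\<^sup>2)"
      by (auto intro: order_trans[OF _ abs_ge_self])
  qed simp
  have "integrable lborel (\<lambda>\<xi>. (2 * pi) powr (real ?n) * (cmod (fourier u \<xi>))\<^sup>2)"
    using i by (rule integrable_mult_right)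
  \<comment> \<open>Undoing the normalization produces the same power of \<open>2 * pi\<close> as in
    \<open>plancherel_lower\<close>, so the constants cancel.\<close>
  moreover have ft_sq: "(2 * pi) powr (real ?n) * (cmod (fourier u \<xi>))\<^sup>2 = (cmod (ft g \<xi>))\<^sup>2" for \<xi>
    by (simp add: sq mult.assoc[symmetric] powr_add[symmetric])
  ultimately have "integrable lborel (\<lambda>\<xi>. (cmod (ft g \<xi>))\<^sup>2)" by simp
  from plancherel_lower[OF g g2(1) gz this]
  have "(2 * pi) ^ ?n * (LBINT x. (cmod (g x))\<^sup>2) \<le> (2 * pi) ^ ?n * (LBINT \<xi>. (cmod (fourier u \<xi>))\<^sup>2)"
    by (simp add: ft_sq[symmetric] powr_realpow)
  then show "(LINT x|lebesgue. (cmod (u x))\<^sup>2) \<le> (LBINT \<xi>. (cmod (fourier u \<xi>))\<^sup>2)"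
    by (simp add: g2)
qed


lemma integral_lebesgue_on_eq:
  fixes h :: "'a::euclidean_space \<Rightarrow> 'b::{banach, second_countable_topology}"
  assumes "h \<in> borel_measurable lebesgue" "\<Omega> \<in> sets lebesgue"
    and "AE x in lebesgue. x \<notin> \<Omega> \<longrightarrow> h x = 0"
  shows "integral\<^sup>L (lebesgue_on \<Omega>) h = integral\<^sup>L lebesgue h"
proof -
  have "integral\<^sup>L (lebesgue_on \<Omega>) h = (LINT x|lebesgue. indicator \<Omega> x *\<^sub>R h x)"
    using assms(2) by (intro integral_restrict_space) simp
  also have "\<dots> = integral\<^sup>L lebesgue h"
  proof (rule integral_cong_AE)
    show "AE x in lebesgue. indicator \<Omega> x *\<^sub>R h x = h x"
      using assms(3) by eventually_elim (auto simp: indicator_def)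
  qed (use assms in auto)
  finally show ?thesis .
qed

text \<open>Since \<open>u\<close> vanishes off \<open>\<Omega>\<close>, its transform at
  \<open>\<xi>\<close> is, up to the constant and conjugation, the coefficient of an exponential
  against \<open>u\<close> on \<open>\<Omega>\<close>. This is the form to which Bessel's inequality
  applies.\<close>

lemma cmod_fourier_power2:
  fixes u :: "real^'n \<Rightarrow> complex"
  assumes u: "u \<in> energy_space s \<Omega>" and \<Omega>: "\<Omega> \<in> sets lebesgue"
  shows "(cmod (fourier u \<xi>))\<^sup>2 = (2 * pi) powr (- real CARD('n)) *
    (cmod (L2_inner (lebesgue_on \<Omega>) (\<lambda>x. exp (\<i> * complex_of_real (x \<bullet> \<xi>))) u))\<^sup>2"
proof -
  let ?e = "\<lambda>x. exp (- (\<i> * complex_of_real (x \<bullet> \<xi>)))"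
  have um: "u \<in> borel_measurable lebesgue" and uz: "AE x in lebesgue. x \<notin> \<Omega> \<longrightarrow> u x = 0"
    using u by (auto simp: energy_space_def L2_def)
  have m: "?e \<in> borel_measurable lebesgue"
    by (rule measurable_completion) simp
  have "(LINT x|lebesgue. u x * ?e x) = (LINT x|lebesgue_on \<Omega>. u x * ?e x)"
    using uz by (intro integral_lebesgue_on_eq[symmetric] borel_measurable_times um m \<Omega>) auto
  also have "\<dots> = cnj (L2_inner (lebesgue_on \<Omega>) (\<lambda>x. exp (\<i> * complex_of_real (x \<bullet> \<xi>))) u)"
    unfolding L2_inner_def Bochner_Integration.integral_cnj[symmetric]
    by (simp add: exp_cnj mult.commute del: Bochner_Integration.integral_cnj)
  finally show ?thesis
    unfolding fourier_def
    by (simp add: norm_mult power_mult_distrib power2_eq_square[of "_ powr _"] powr_add[symmetric])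
qed

text \<open>Exponentials have modulus 1, so their squared norm on \<open>\<Omega>\<close> is its
  volume; this is how the volume enters the bounds.\<close>

lemma
  fixes \<Omega> :: "'a::euclidean_space set"
  assumes "\<Omega> \<in> lmeasurable"
  shows L2_iexp: "(\<lambda>x. exp (\<i> * complex_of_real (x \<bullet> \<xi>))) \<in> L2 (lebesgue_on \<Omega>)"
    and L2_norm_iexp: "(LINT x|lebesgue_on \<Omega>. (cmod (exp (\<i> * complex_of_real (x \<bullet> \<xi>))))\<^sup>2) = measure lebesgue \<Omega>"
proof -
  have s: "\<Omega> \<in> sets lebesgue" using assms by auto
  interpret finite_measure "lebesgue_on \<Omega>"
    using assms by (rule finite_measure_lebesgue_on)
  have m: "(\<lambda>x. exp (\<i> * complex_of_real (x \<bullet> \<xi>))) \<in> borel_measurable (lebesgue_on \<Omega>)"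
    by (intro measurable_restrict_space1 measurable_completion) simp
  then show "(\<lambda>x. exp (\<i> * complex_of_real (x \<bullet> \<xi>))) \<in> L2 (lebesgue_on \<Omega>)"
    by (simp add: L2_def)
  show "(LINT x|lebesgue_on \<Omega>. (cmod (exp (\<i> * complex_of_real (x \<bullet> \<xi>))))\<^sup>2) = measure lebesgue \<Omega>"
    using s by (simp add: measure_restrict_space)
qed

lemma energy_diag:
  "energy s u u = complex_of_real (LINT \<xi>|lebesgue. fraclog_symbol s \<xi> * (cmod (fourier u \<xi>))\<^sup>2)"
  unfolding energy_def integral_complex_of_real[symmetric] of_real_mult complex_norm_square mult.assoc ..

lemma measure_lebesgue_open_pos:
  fixes \<Omega> :: "'a::euclidean_space set"
  assumes "open \<Omega>" "\<Omega> \<noteq> {}" "bounded \<Omega>"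
  shows "0 < measure lebesgue \<Omega>"
proof -
  obtain x e where e: "0 < e" "ball x e \<subseteq> \<Omega>"
    using assms open_contains_ball by (metis ex_in_conv)
  have "0 < measure lebesgue (ball x e)" using e(1) by (simp add: content_ball)
  also have "\<dots> \<le> measure lebesgue \<Omega>"
    using e assms by (intro measure_mono_fmeasurable lmeasurable_open) auto
  finally show ?thesis .
qed

section \<open>Lower bounds for the eigenvalue sums\<close>

theorem theorem2p5:
  fixes n :: nat and s :: real and \<Omega> :: "(real^'n) set" and lam :: "nat \<Rightarrow> real"
  assumes "n = CARD('n)"
    and "0 < s" and "s < 1"
    and "open \<Omega>" and "connected \<Omega>" and "\<Omega> \<noteq> {}" and "bounded \<Omega>"
    and "dirichlet_eigenvalues s \<Omega> lam"
  shows "\<forall>k::nat. 1 \<le> k \<longrightarrow>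
     (\<Sum>j=1..k. lam j) \<ge>
       - ((2 * pi) powr (- real n) * (2 * real n * unit_ball_vol (real n) / (real n + 2 * s)\<^sup>2)
          * measure lebesgue \<Omega>) \<and>
     (real k \<ge> (2 * pi) powr (- real n) * unit_ball_vol (real n) * measure lebesgue \<Omega> \<longrightarrow>
      (\<Sum>j=1..k. lam j) \<ge>
       2 / (real n + 2 * s) * (2 * pi) powr (2 * s)
       * (unit_ball_vol (real n) * measure lebesgue \<Omega>) powr (- 2 * s / real n)
       * real k powr (1 + 2 * s / real n)
       * (ln ((2 * pi) ^ n * real k / (unit_ball_vol (real n) * measure lebesgue \<Omega>))
          - real n / (real n + 2 * s)))"
proof (intro allI impI)
  fix k :: nat
  assume k: "1 \<le> k"
  have s: "0 < s" by fact
  obtain \<phi> where on: "L2_orthonormal_basis (lebesgue_on \<Omega>) \<phi>"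
    and es: "\<And>j. 1 \<le> j \<Longrightarrow> \<phi> j \<in> energy_space s \<Omega>"
    and ev: "\<And>j v. 1 \<le> j \<Longrightarrow> v \<in> energy_space s \<Omega> \<Longrightarrow>
      energy s (\<phi> j) v = complex_of_real (lam j) * L2_inner (lebesgue_on \<Omega>) (\<phi> j) v"
    using \<open>dirichlet_eigenvalues s \<Omega> lam\<close> unfolding dirichlet_eigenvalues_def by blast
  have L2\<phi>: "\<And>j. 1 \<le> j \<Longrightarrow> \<phi> j \<in> L2 (lebesgue_on \<Omega>)"
    and inner: "\<And>i j. 1 \<le> i \<Longrightarrow> 1 \<le> j \<Longrightarrow> L2_inner (lebesgue_on \<Omega>) (\<phi> i) (\<phi> j) = (if i = j then 1 else 0)"
    using on unfolding L2_orthonormal_basis_def by auto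
  have \<Omega>: "\<Omega> \<in> lmeasurable" "\<Omega> \<in> sets lebesgue"
    using lmeasurable_open[OF \<open>bounded \<Omega>\<close> \<open>open \<Omega>\<close>] by auto
  have n: "n = CARD('n)" "0 < n" using \<open>n = CARD('n)\<close> by auto
  define \<mu> where "\<mu> = measure lebesgue \<Omega>"
  define \<omega> where "\<omega> = unit_ball_vol (real n)"
  define M where "M = (2 * pi) powr (- real n) * \<mu>"
  define a where "a = real n + 2 * s"
  have pos: "0 < \<mu>" "0 < \<omega>" "0 < M" "0 < a"
    using measure_lebesgue_open_pos[OF \<open>open \<Omega>\<close> \<open>\<Omega> \<noteq> {}\<close> \<open>bounded \<Omega>\<close>] s by (auto simp: \<mu>_def \<omega>_def M_def a_def)
  define F where "F \<xi> = (\<Sum>j=1..k. (cmod (fourier (\<phi> j) \<xi>))\<^sup>2)" for \<xi>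
  have F0: "0 \<le> F \<xi>" for \<xi> unfolding F_def by (intro sum_nonneg) simp
  \<comment> \<open>For fixed \<open>\<xi>\<close> the summands are coefficients of one exponential
    against the orthonormal family, and Bessel's inequality bounds their sum by the volume.\<close>
  have FM: "F \<xi> \<le> M" for \<xi>
  proof -
    let ?e = "\<lambda>x. exp (\<i> * complex_of_real (x \<bullet> \<xi>))"
    have "F \<xi> = (2 * pi) powr (- real n) * (\<Sum>j=1..k. (cmod (L2_inner (lebesgue_on \<Omega>) ?e (\<phi> j)))\<^sup>2)"
      unfolding F_def sum_distrib_left
      by (intro sum.cong) (auto simp: cmod_fourier_power2[OF es \<Omega>(2)] n)
    also have "\<dots> \<le> (2 * pi) powr (- real n) * \<mu>"
      unfolding \<mu>_def L2_norm_iexp[OF \<Omega>(1), of \<xi>, symmetric]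
      by (intro mult_left_mono L2_bessel L2\<phi> inner L2_iexp \<Omega>) auto
    finally show ?thesis by (simp add: M_def)
  qed
  \<comment> \<open>Orthonormality is over \<open>\<Omega>\<close>, Plancherel over the whole space;
    the integrals agree as \<open>\<phi> j\<close> vanishes almost everywhere off
    \<open>\<Omega>\<close>.\<close>
  have norm1: "(LINT x|lebesgue. (cmod (\<phi> j x))\<^sup>2) = 1" if j: "1 \<le> j" for j
  proof -
    have "\<phi> j \<in> borel_measurable lebesgue" "AE x in lebesgue. x \<notin> \<Omega> \<longrightarrow> \<phi> j x = 0"
      using es[OF j] by (auto simp: energy_space_def L2_def)
    then have "(LINT x|lebesgue_on \<Omega>. (cmod (\<phi> j x))\<^sup>2) = (LINT x|lebesgue. (cmod (\<phi> j x))\<^sup>2)"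
      by (intro integral_lebesgue_on_eq \<Omega>) auto
    moreover have "complex_of_real (LINT x|lebesgue_on \<Omega>. (cmod (\<phi> j x))\<^sup>2) = L2_inner (lebesgue_on \<Omega>) (\<phi> j) (\<phi> j)"
      unfolding L2_inner_def by (simp only: complex_norm_square[symmetric] integral_complex_of_real)
    ultimately show ?thesis using inner[OF j j] by simp
  qed
  note four = energy_space_fourier[OF es \<open>bounded \<Omega>\<close> s]
  have lam: "lam j = (LBINT \<xi>. fraclog_symbol s \<xi> * (cmod (fourier (\<phi> j) \<xi>))\<^sup>2)" if j: "1 \<le> j" for j
  proof -
    \<comment> \<open>The weak eigenvalue equation is tested with the eigenfunction itself.\<close>
    have "complex_of_real (lam j) = energy s (\<phi> j) (\<phi> j)"
      using ev[OF j es[OF j]] inner[OF j j] by simp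
    then have "lam j = (LINT \<xi>|lebesgue. fraclog_symbol s \<xi> * (cmod (fourier (\<phi> j) \<xi>))\<^sup>2)"
      unfolding energy_diag of_real_eq_iff .
    also have "\<dots> = (LBINT \<xi>. fraclog_symbol s \<xi> * (cmod (fourier (\<phi> j) \<xi>))\<^sup>2)"
      using four(1)[OF j] by (intro integral_completion) simp
    finally show ?thesis .
  qed
  have iF: "integrable lborel F"
    unfolding F_def[abs_def] by (intro Bochner_Integration.integrable_sum four(3)) auto
  have isF: "integrable lborel (\<lambda>\<xi>. fraclog_symbol s \<xi> * F \<xi>)"
    unfolding F_def sum_distrib_left by (intro Bochner_Integration.integrable_sum four(2)) auto
  have sum_lam: "(\<Sum>j=1..k. lam j) = (LBINT \<xi>. fraclog_symbol s \<xi> * F \<xi>)"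
    unfolding F_def sum_distrib_left
    by (subst Bochner_Integration.integral_sum) (auto simp: lam intro!: four(2))
  have mass: "real k \<le> (LBINT \<xi>. F \<xi>)"
  proof -
    have "real k = (\<Sum>j=1..k. LINT x|lebesgue. (cmod (\<phi> j x))\<^sup>2)" by (simp add: norm1)
    also have "\<dots> \<le> (\<Sum>j=1..k. LBINT \<xi>. (cmod (fourier (\<phi> j) \<xi>))\<^sup>2)"
      by (intro sum_mono four(4)) auto
    also have "\<dots> = (LBINT \<xi>. F \<xi>)"
      unfolding F_def by (subst Bochner_Integration.integral_sum) (auto intro!: four(3))
    finally show ?thesis .
  qed
  have I: "(LBINT \<xi>::real^'n. indicator (cball 0 R) \<xi> * fraclog_symbol s \<xi>) =
      2 * real n * \<omega> * (R powr a * (ln R / a - 1 / a\<^sup>2))" if "0 < R" for R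
    using integral_fraclog_symbol_cball[OF s that, where 'n = 'n] by (simp add: n \<omega>_def a_def)
  \<comment> \<open>The ball has radius 1, so the logarithm vanishes and only the term
    \<open>- 1 / a\<^sup>2\<close> remains.\<close>
  have "M * (2 * real n * \<omega> * (1 powr a * (ln 1 / a - 1 / a\<^sup>2))) \<le> (\<Sum>j=1..k. lam j)"
    using fraclog_bathtub_negative_part[OF s F0 FM isF] unfolding sum_lam I[OF zero_less_one] .
  then have part1: "- ((2 * pi) powr (- real n) * (2 * real n * \<omega> / a\<^sup>2) * \<mu>) \<le> (\<Sum>j=1..k. lam j)"
    by (simp add: M_def mult_ac)
  have part2: "2 / a * (2 * pi) powr (2 * s) * (\<omega> * \<mu>) powr (- 2 * s / real n) * real k powr (1 + 2 * s / real n)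
      * (ln ((2 * pi) ^ n * real k / (\<omega> * \<mu>)) - real n / a) \<le> (\<Sum>j=1..k. lam j)"
    if kge: "(2 * pi) powr (- real n) * \<omega> * \<mu> \<le> real k"
  proof -
    \<comment> \<open>\<open>q\<close> is the n-th power of the radius \<open>R\<close> at which
      \<open>M * \<omega> * R ^ n\<close> equals \<open>k\<close>; the assumption on
      \<open>k\<close> says exactly that \<open>q\<close>, hence \<open>R\<close>, is at least
      1.\<close>
    define q where "q = (2 * pi) ^ n * real k / (\<omega> * \<mu>)"
    define R where "R = q powr (1 / real n)"
    have kpos: "0 < real k" using k by simp
    have Mq: "M * \<omega> * q = real k"
      using pos by (simp add: M_def q_def powr_minus powr_realpow field_simps)
    have "M * \<omega> * 1 \<le> M * \<omega> * q"
      unfolding Mq using kge by (simp add: M_def mult_ac)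
    then have q1: "1 \<le> q" using pos by simp
    then have R1: "1 \<le> R" unfolding R_def by (simp add: ge_one_powr_ge_zero)
    have Rn: "R ^ n = q"
      using q1 n by (simp add: R_def powr_realpow[symmetric] powr_powr)
    have "M * measure lborel (cball (0::real^'n) R) = real k"
      using R1 Mq Rn n by (simp add: content_cball \<omega>_def mult_ac)
    then have main: "M * (2 * real n * \<omega> * (R powr a * (ln R / a - 1 / a\<^sup>2))) \<le> (\<Sum>j=1..k. lam j)"
      using fraclog_bathtub[OF s R1 F0 FM iF isF] mass R1 unfolding sum_lam by (simp add: I)
    have Ra: "R powr a = q * q powr (2 * s / real n)"
      using q1 n by (simp add: R_def a_def powr_powr powr_add[symmetric] field_simps powr_add)
    have lnR: "ln R = ln q / real n"
      using q1 by (simp add: R_def ln_powr)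
    \<comment> \<open>The factor \<open>(2 * pi) ^ n\<close> of \<open>q\<close>, raised to the
      power 2s/n, becomes \<open>(2 * pi) powr (2 * s)\<close>.\<close>
    have qp: "q powr (2 * s / real n) =
        (2 * pi) powr (2 * s) * (\<omega> * \<mu>) powr (- 2 * s / real n) * real k powr (2 * s / real n)"
      using pos kpos n by (simp add: q_def powr_divide powr_mult powr_realpow[symmetric] powr_powr powr_minus field_simps)
    have kp: "real k powr (1 + 2 * s / real n) = real k * real k powr (2 * s / real n)"
      using kpos by (simp add: powr_add)
    \<comment> \<open>\<open>Q\<close> stands for \<open>q powr (2 * s / real n)\<close>; keeping it
      abstract leaves only field arithmetic and \<open>Mq\<close>.\<close>
    have alg: "M * (2 * real n * \<omega> * (q * Q * (ln q / real n / a - 1 / a\<^sup>2))) =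
        2 / a * real k * Q * (ln q - real n / a)" for Q
    proof -
      have "M * (2 * real n * \<omega> * (q * Q * (ln q / real n / a - 1 / a\<^sup>2))) =
        (M * \<omega> * q) * (2 * real n * Q * (ln q / real n / a - 1 / a\<^sup>2))" by simp
      also have "\<dots> = 2 / a * real k * Q * (ln q - real n / a)"
        unfolding Mq using n pos by (simp add: field_simps power2_eq_square)
      finally show ?thesis .
    qed
    have "2 / a * real k * q powr (2 * s / real n) * (ln q - real n / a) \<le> (\<Sum>j=1..k. lam j)"
      using main unfolding Ra lnR alg .
    then show ?thesis unfolding q_def[symmetric] qp kp by (simp only: mult_ac)
  qed
  show "(\<Sum>j=1..k. lam j) \<ge>
       - ((2 * pi) powr (- real n) * (2 * real n * unit_ball_vol (real n) / (real n + 2 * s)\<^sup>2)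
          * measure lebesgue \<Omega>) \<and>
     (real k \<ge> (2 * pi) powr (- real n) * unit_ball_vol (real n) * measure lebesgue \<Omega> \<longrightarrow>
      (\<Sum>j=1..k. lam j) \<ge>
       2 / (real n + 2 * s) * (2 * pi) powr (2 * s)
       * (unit_ball_vol (real n) * measure lebesgue \<Omega>) powr (- 2 * s / real n)
       * real k powr (1 + 2 * s / real n)
       * (ln ((2 * pi) ^ n * real k / (unit_ball_vol (real n) * measure lebesgue \<Omega>))
          - real n / (real n + 2 * s)))"
    using part1 part2 unfolding \<mu>_def \<omega>_def a_def by blast
qed

end
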